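(* Every atomic, measurable relation algebra $\mathfrak B$ is essentially isomorphic to a coset relation algebra; that is, there is a coset relation algebra $\mathfrak C[\mathcal F]$ such that the completion of $\mathfrak B$ is isomorphic to $\mathfrak C[\mathcal F]$.
   Context: **Relation algebras.** A relation algebra is an algebra $\mathfrak A=(A,+,-,;,{}^{\smile},1')$ such that $(A,+,-)$ is a Boolean algebra and for all $r,s,t$: $r;(s;t)=(r;s);t$, $r;1'=r$, $r^{\smile\smile}=r$, $(r;s)^\smile=s^\smile;r^\smile$, $(r+s);t=r;t+s;t$, $(r+s)^\smile=r^\smile+s^\smile$, $r^\smile;-(r;s)+-s=-s$. Order, product $\cdot$, $0$, $1$, suprema $\sum$, atoms, atomicity and completeness refer to the Boolean part. A function is an element $f$ with $f^\smile;f\le 1'$. A subidentity atom is an atom $x\le 1'$; it is measurable if $x;1;x$ is the sum (supremum) of a set of functions. A relation algebra is measurable if $1'$ is the sum of a set of measurable atoms. The completion of $\mathfrak B$ is its minimal complete extension: the (unique up to isomorphism over $\mathfrak B$) complete relation algebra having $\mathfrak B$ as a subalgebra and whose Boolean part is the Boolean completion of that of $\mathfrak B$ (so $\mathfrak B$ is dense in it). $\mathfrak B$ is essentially isomorphic to $\mathfrak C$ if the completion of $\mathfrak B$ is isomorphic to $\mathfrak C$. **Group triples and semi-frames.** A group triple $\mathcal F=(G,\varphi,C)$ consists of: a system $G=\langle G_x:x\in I\rangle$ of pairwise disjoint groups (with $e_x$ the identity of $G_x$); a system $\varphi=\langle\varphi_{xy}:(x,y)\in\mathcal E\rangle$, where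 $\mathcal E$ is a fixed equivalence relation on $I$ and each $\varphi_{xy}$ is a group isomorphism from a quotient $G_x/H_{xy}$ to a quotient $G_y/K_{xy}$ ($H_{xy}$, $K_{xy}$ normal subgroups of $G_x$, $G_y$); and a system $C=\langle C_{xyz}:(x,y,z)\in\mathcal E_3\rangle$, where $\mathcal E_3=\{(x,y,z):(x,y),(y,z)\in\mathcal E\}$ and $C_{xyz}$ is a coset of $H_{xy}H_{xz}$ in $G_x$. For a union $N$ of cosets of $H_{xy}$, $\varphi_{xy}[N]$ is the union of the images under $\varphi_{xy}$ of the cosets of $H_{xy}$ included in $N$; inverse images $\varphi_{xy}^{-1}[\cdot]$ are defined in the same way on unions of cosets of $K_{xy}$. The triple is a (coset) semi-frame if (i) $\varphi_{xx}$ is the identity automorphism of $G_x/\{e_x\}$ for all $x\in I$; (ii) $\varphi_{yx}=\varphi_{xy}^{-1}$ for $(x,y)\in\mathcal E$; (iii) $\varphi_{xy}[H_{xy}H_{xz}]=K_{xy}H_{yz}$ for $(x,y,z)\in\mathcal E_3$; (iv) $\hat\varphi_{xy}|\hat\varphi_{yz}=\tau|\hat\varphi_{xz}$ for $(x,y,z)\in\mathcal E_3$, where $|$ is composition applying the left map first; $\hat\varphi_{xy}:G_x/(H_{xy}H_{xz})\to G_y/(K_{xy}H_{yz})$, $\hat\varphi_{yz}:G_y/(K_{xy}H_{yz})\to G_z/(K_{xz}K_{yz})$ and $\hat\varphi_{xz}:G_x/(H_{xy}H_{xz})\to G_z/(K_{xz}K_{yz})$ are the isomorphisms induced by $\varphi_{xy},\varphi_{yz},\varphi_{xz}$;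 and $\tau$ is the inner automorphism $D\mapsto C_{xyz}^{-1}DC_{xyz}$ of $G_x/(H_{xy}H_{xz})$. **The algebra $\mathfrak C[\mathcal F]$.** Let $\mathcal F$ be a semi-frame and $U=\bigcup_{x\in I}G_x$. For $(x,y)\in\mathcal E$ and $\alpha\in G_x/H_{xy}$ put $$R_{xy,\alpha}=\bigcup\{\xi\times(\varphi_{xy}(\xi)\varphi_{xy}(\alpha)):\xi\in G_x/H_{xy}\}\subseteq G_x\times G_y.$$ These relations are nonempty and pairwise disjoint. The universe of $\mathfrak C[\mathcal F]$ is the set of all unions of sets of these relations. Its operations are: set-theoretic union; complement relative to the union $\bigcup\{G_x\times G_y:(x,y)\in\mathcal E\}$ of all $R_{xy,\alpha}$; set-theoretic converse of relations (as converse); the identity relation $id_U$ (as identity element); and the binary operation $\otimes$ (as relative multiplication), which is completely distributive over unions in each argument and is given on the $R$'s by $R_{xy,\alpha}\otimes R_{wz,\beta}=\varnothing$ if $y\ne w$, and $$R_{xy,\alpha}\otimes R_{yz,\beta}=\bigcup\{R_{xz,\gamma}:\gamma\in G_x/H_{xz},\ \gamma\subseteq\varphi_{xy}^{-1}[\varphi_{xy}(\alpha)\beta]\,C_{xyz}\}$$ for $\alpha\in G_x/H_{xy}$, $\beta\in G_y/H_{yz}$. A coset relation algebra is an algebra $\mathfrak C[\mathcal F]$, with $\mathcal F$ a semi-frame, that is a relation algebra. *)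

theory Defs
  imports "HOL-Algebra.Coset" "HOL-Algebra.Complete_Lattice"
begin

section \<open>Relation algebras\<close>

text \<open>
  Algebras are records with an explicit carrier, so that the completion of an algebra and the
  algebras built from group triples are objects of the same kind as the given algebra.
  The similarity type is \<open>(A, +, -, ;, conv, 1')\<close>; all other Boolean notions are derived.
\<close>

record 'a rel_alg = "'a partial_object" +
  ra_join :: "'a \<Rightarrow> 'a \<Rightarrow> 'a" (infixl \<open>\<uplus>\<index>\<close> 65)
  ra_compl :: "'a \<Rightarrow> 'a" (\<open>\<sim>\<index> _\<close> [81] 80)
  ra_comp :: "'a \<Rightarrow> 'a \<Rightarrow> 'a" (infixl \<open>;;\<index>\<close> 70)
  ra_conv :: "'a \<Rightarrow> 'a" (\<open>conv\<index> _\<close> [81] 80)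
  ra_id :: 'a (\<open>\<iota>\<index>\<close>)

definition ra_meet :: "('a, 'm) rel_alg_scheme \<Rightarrow> 'a \<Rightarrow> 'a \<Rightarrow> 'a" where
  "ra_meet A a b = \<sim>\<^bsub>A\<^esub> (\<sim>\<^bsub>A\<^esub> a \<uplus>\<^bsub>A\<^esub> \<sim>\<^bsub>A\<^esub> b)"

definition ra_zero :: "('a, 'm) rel_alg_scheme \<Rightarrow> 'a" where
  "ra_zero A = (THE z. z \<in> carrier A \<and> (\<forall>a\<in>carrier A. a \<uplus>\<^bsub>A\<^esub> z = a))"

definition ra_one :: "('a, 'm) rel_alg_scheme \<Rightarrow> 'a" where
  "ra_one A = \<sim>\<^bsub>A\<^esub> ra_zero A"

definition ra_le :: "('a, 'm) rel_alg_scheme \<Rightarrow> 'a \<Rightarrow> 'a \<Rightarrow> bool" where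
  "ra_le A a b \<longleftrightarrow> a \<uplus>\<^bsub>A\<^esub> b = b"

definition ra_order :: "('a, 'm) rel_alg_scheme \<Rightarrow> 'a gorder" where
  "ra_order A = \<lparr>carrier = carrier A, eq = (=), le = ra_le A\<rparr>"

text \<open>
  The axioms are those of the library locale \<open>abstract_boolean_algebra\<close>, relativised to the carrier.
  The one-element Boolean algebra is admitted.
\<close>

locale boolean_part =
  fixes A :: "('a, 'm) rel_alg_scheme" (structure)
  assumes join_closed: "\<lbrakk>a \<in> carrier A; b \<in> carrier A\<rbrakk> \<Longrightarrow> a \<uplus> b \<in> carrier A"
    and compl_closed: "a \<in> carrier A \<Longrightarrow> \<sim> a \<in> carrier A"
    and zero_closed: "ra_zero A \<in> carrier A"
    and join_assoc: "\<lbrakk>a \<in> carrier A; b \<in> carrier A; c \<in> carrier A\<rbrakk>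
      \<Longrightarrow> (a \<uplus> b) \<uplus> c = a \<uplus> (b \<uplus> c)"
    and join_commute: "\<lbrakk>a \<in> carrier A; b \<in> carrier A\<rbrakk> \<Longrightarrow> a \<uplus> b = b \<uplus> a"
    and meet_assoc: "\<lbrakk>a \<in> carrier A; b \<in> carrier A; c \<in> carrier A\<rbrakk>
      \<Longrightarrow> ra_meet A (ra_meet A a b) c = ra_meet A a (ra_meet A b c)"
    and meet_commute: "\<lbrakk>a \<in> carrier A; b \<in> carrier A\<rbrakk> \<Longrightarrow> ra_meet A a b = ra_meet A b a"
    and meet_join_distrib: "\<lbrakk>a \<in> carrier A; b \<in> carrier A; c \<in> carrier A\<rbrakk>
      \<Longrightarrow> ra_meet A a (b \<uplus> c) = ra_meet A a b \<uplus> ra_meet A a c"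
    and join_meet_distrib: "\<lbrakk>a \<in> carrier A; b \<in> carrier A; c \<in> carrier A\<rbrakk>
      \<Longrightarrow> a \<uplus> ra_meet A b c = ra_meet A (a \<uplus> b) (a \<uplus> c)"
    and join_zero: "a \<in> carrier A \<Longrightarrow> a \<uplus> ra_zero A = a"
    and meet_one: "a \<in> carrier A \<Longrightarrow> ra_meet A a (ra_one A) = a"
    and join_compl: "a \<in> carrier A \<Longrightarrow> a \<uplus> \<sim> a = ra_one A"
    and meet_compl: "a \<in> carrier A \<Longrightarrow> ra_meet A a (\<sim> a) = ra_zero A"

locale relation_algebra = boolean_part +
  assumes comp_closed: "\<lbrakk>r \<in> carrier A; s \<in> carrier A\<rbrakk> \<Longrightarrow> r ;; s \<in> carrier A"
    and conv_closed: "r \<in> carrier A \<Longrightarrow> conv r \<in> carrier A"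
    and id_closed: "\<iota> \<in> carrier A"
    and comp_assoc: "\<lbrakk>r \<in> carrier A; s \<in> carrier A; t \<in> carrier A\<rbrakk>
      \<Longrightarrow> r ;; (s ;; t) = (r ;; s) ;; t"
    and comp_id: "r \<in> carrier A \<Longrightarrow> r ;; \<iota> = r"
    and conv_conv: "r \<in> carrier A \<Longrightarrow> conv (conv r) = r"
    and conv_comp: "\<lbrakk>r \<in> carrier A; s \<in> carrier A\<rbrakk> \<Longrightarrow> conv (r ;; s) = conv s ;; conv r"
    and join_comp_distrib: "\<lbrakk>r \<in> carrier A; s \<in> carrier A; t \<in> carrier A\<rbrakk>
      \<Longrightarrow> (r \<uplus> s) ;; t = (r ;; t) \<uplus> (s ;; t)"
    and conv_join: "\<lbrakk>r \<in> carrier A; s \<in> carrier A\<rbrakk> \<Longrightarrow> conv (r \<uplus> s) = conv r \<uplus> conv s"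
    and tarski: "\<lbrakk>r \<in> carrier A; s \<in> carrier A\<rbrakk>
      \<Longrightarrow> (conv r ;; \<sim> (r ;; s)) \<uplus> \<sim> s = \<sim> s"

definition ra_is_sup :: "('a, 'm) rel_alg_scheme \<Rightarrow> 'a set \<Rightarrow> 'a \<Rightarrow> bool" where
  "ra_is_sup A S a \<longleftrightarrow> S \<subseteq> carrier A \<and> least (ra_order A) a (Upper (ra_order A) S)"

definition ra_complete :: "('a, 'm) rel_alg_scheme \<Rightarrow> bool" where
  "ra_complete A \<longleftrightarrow> complete_lattice (ra_order A)"

definition ra_atom :: "('a, 'm) rel_alg_scheme \<Rightarrow> 'a \<Rightarrow> bool" where
  "ra_atom A x \<longleftrightarrow> x \<in> carrier A \<and> x \<noteq> ra_zero A \<and>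
     (\<forall>a\<in>carrier A. ra_le A a x \<longrightarrow> a = ra_zero A \<or> a = x)"

definition ra_atomic :: "('a, 'm) rel_alg_scheme \<Rightarrow> bool" where
  "ra_atomic A \<longleftrightarrow> (\<forall>a\<in>carrier A. a \<noteq> ra_zero A \<longrightarrow> (\<exists>x. ra_atom A x \<and> ra_le A x a))"

definition ra_function :: "('a, 'm) rel_alg_scheme \<Rightarrow> 'a \<Rightarrow> bool" where
  "ra_function A f \<longleftrightarrow> f \<in> carrier A \<and> ra_le A (conv\<^bsub>A\<^esub> f ;;\<^bsub>A\<^esub> f) \<iota>\<^bsub>A\<^esub>"

definition measurable_atom :: "('a, 'm) rel_alg_scheme \<Rightarrow> 'a \<Rightarrow> bool" where
  "measurable_atom A x \<longleftrightarrow> ra_atom A x \<and> ra_le A x \<iota>\<^bsub>A\<^esub> \<and>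
     (\<exists>S. (\<forall>f\<in>S. ra_function A f) \<and> ra_is_sup A S (x ;;\<^bsub>A\<^esub> ra_one A ;;\<^bsub>A\<^esub> x))"

definition ra_measurable :: "('a, 'm) rel_alg_scheme \<Rightarrow> bool" where
  "ra_measurable A \<longleftrightarrow> (\<exists>S. (\<forall>x\<in>S. measurable_atom A x) \<and> ra_is_sup A S \<iota>\<^bsub>A\<^esub>)"


section \<open>Isomorphisms and completions\<close>

definition ra_hom :: "('a, 'm) rel_alg_scheme \<Rightarrow> ('b, 'n) rel_alg_scheme \<Rightarrow> ('a \<Rightarrow> 'b) set" where
  "ra_hom A B = {h. h \<in> carrier A \<rightarrow> carrier B \<and>
     (\<forall>a\<in>carrier A. \<forall>b\<in>carrier A. h (a \<uplus>\<^bsub>A\<^esub> b) = h a \<uplus>\<^bsub>B\<^esub> h b) \<and>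
     (\<forall>a\<in>carrier A. h (\<sim>\<^bsub>A\<^esub> a) = \<sim>\<^bsub>B\<^esub> h a) \<and>
     (\<forall>a\<in>carrier A. \<forall>b\<in>carrier A. h (a ;;\<^bsub>A\<^esub> b) = h a ;;\<^bsub>B\<^esub> h b) \<and>
     (\<forall>a\<in>carrier A. h (conv\<^bsub>A\<^esub> a) = conv\<^bsub>B\<^esub> h a) \<and>
     h \<iota>\<^bsub>A\<^esub> = \<iota>\<^bsub>B\<^esub>}"

definition ra_isomorphic :: "('a, 'm) rel_alg_scheme \<Rightarrow> ('b, 'n) rel_alg_scheme \<Rightarrow> bool" where
  "ra_isomorphic A B \<longleftrightarrow> (\<exists>h\<in>ra_hom A B. bij_betw h (carrier A) (carrier B))"

text \<open>
  \<open>A\<close> is a completion of \<open>B\<close>. Since \<open>A\<close> and \<open>B\<close> may have different element types, the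
  requirement that \<open>B\<close> be a subalgebra of \<open>A\<close> is expressed by an embedding \<open>e\<close>. A complete
  Boolean algebra is the Boolean completion of a subalgebra iff that subalgebra is dense in it,
  that is, iff every nonzero element lies above a nonzero element of the subalgebra.
\<close>

definition is_completion :: "('b, 'n) rel_alg_scheme \<Rightarrow> ('a, 'm) rel_alg_scheme \<Rightarrow> bool" where
  "is_completion A B \<longleftrightarrow> relation_algebra A \<and> ra_complete A \<and>
     (\<exists>e\<in>ra_hom B A. inj_on e (carrier B) \<and>
       (\<forall>a\<in>carrier A. a \<noteq> ra_zero A \<longrightarrow>
         (\<exists>b\<in>carrier B. b \<noteq> ra_zero B \<and> ra_le A (e b) a)))"

text \<open>
  The completion of \<open>B\<close> is isomorphic to \<open>C\<close>. As the completion is determined only up to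
  isomorphism, we ask that it exist and that each of its versions be isomorphic to \<open>C\<close>.
  The element type \<open>'a set\<close> is no restriction: by density an element \<open>a\<close> of a completion is
  determined by the set of \<open>b\<close> in \<open>B\<close> with \<open>e b \<le> a\<close>, so every completion has a copy there.
\<close>

definition essentially_isomorphic :: "'a rel_alg \<Rightarrow> 'b rel_alg \<Rightarrow> bool" where
  "essentially_isomorphic B C \<longleftrightarrow>
     (\<exists>A :: 'a set rel_alg. is_completion A B) \<and>
     (\<forall>A :: 'a set rel_alg. is_completion A B \<longrightarrow> ra_isomorphic A C)"


section \<open>Group triples and semi-frames\<close>

record ('i, 'g) group_triple =
  gt_index :: "'i set"
  gt_eqv :: "('i \<times> 'i) set"
  gt_group :: "'i \<Rightarrow> 'g monoid"
  gt_H :: "'i \<Rightarrow> 'i \<Rightarrow> 'g set"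
  gt_K :: "'i \<Rightarrow> 'i \<Rightarrow> 'g set"
  gt_phi :: "'i \<Rightarrow> 'i \<Rightarrow> 'g set \<Rightarrow> 'g set"
  gt_C :: "'i \<Rightarrow> 'i \<Rightarrow> 'i \<Rightarrow> 'g set"

text \<open>
  The data \<open>H\<close>, \<open>K\<close>, \<open>phi\<close>, \<open>C\<close> are only relevant at indices in the equivalence relation (resp. at
  triples of equivalent indices), and \<open>phi x y\<close> only on the cosets of \<open>H x y\<close>.
\<close>

locale is_group_triple =
  fixes F :: "('i, 'g) group_triple"
  assumes group: "x \<in> gt_index F \<Longrightarrow> group (gt_group F x)"
    and disjoint: "\<lbrakk>x \<in> gt_index F; y \<in> gt_index F; x \<noteq> y\<rbrakk>
      \<Longrightarrow> carrier (gt_group F x) \<inter> carrier (gt_group F y) = {}"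
    and eqv: "equiv (gt_index F) (gt_eqv F)"
    and normal_H: "(x, y) \<in> gt_eqv F \<Longrightarrow> gt_H F x y \<lhd> gt_group F x"
    and normal_K: "(x, y) \<in> gt_eqv F \<Longrightarrow> gt_K F x y \<lhd> gt_group F y"
    and phi_iso: "(x, y) \<in> gt_eqv F
      \<Longrightarrow> gt_phi F x y \<in> iso (gt_group F x Mod gt_H F x y) (gt_group F y Mod gt_K F x y)"
    and C_coset: "\<lbrakk>(x, y) \<in> gt_eqv F; (y, z) \<in> gt_eqv F\<rbrakk>
      \<Longrightarrow> gt_C F x y z \<in>
        rcosets\<^bsub>gt_group F x\<^esub> (gt_H F x y <#>\<^bsub>gt_group F x\<^esub> gt_H F x z)"

text \<open>\<open>phi x y\<close> and its inverse, extended to unions of cosets.\<close>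

definition gt_image :: "('i, 'g) group_triple \<Rightarrow> 'i \<Rightarrow> 'i \<Rightarrow> 'g set \<Rightarrow> 'g set" where
  "gt_image F x y N =
     \<Union> (gt_phi F x y ` {\<xi> \<in> rcosets\<^bsub>gt_group F x\<^esub> gt_H F x y. \<xi> \<subseteq> N})"

definition gt_phi_inv :: "('i, 'g) group_triple \<Rightarrow> 'i \<Rightarrow> 'i \<Rightarrow> 'g set \<Rightarrow> 'g set" where
  "gt_phi_inv F x y = inv_into (rcosets\<^bsub>gt_group F x\<^esub> gt_H F x y) (gt_phi F x y)"

definition gt_inv_image :: "('i, 'g) group_triple \<Rightarrow> 'i \<Rightarrow> 'i \<Rightarrow> 'g set \<Rightarrow> 'g set" where
  "gt_inv_image F x y M =
     \<Union> (gt_phi_inv F x y ` {\<eta> \<in> rcosets\<^bsub>gt_group F y\<^esub> gt_K F x y. \<eta> \<subseteq> M})"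

text \<open>
  In the last axiom the isomorphisms induced by \<open>phi x y\<close>, \<open>phi y z\<close>, \<open>phi x z\<close> on the coarser
  quotients send a coset \<open>D\<close>, viewed as a union of cosets of the finer subgroup, to its image.
\<close>

locale semi_frame = is_group_triple +
  assumes phi_refl_H: "x \<in> gt_index F \<Longrightarrow> gt_H F x x = {\<one>\<^bsub>gt_group F x\<^esub>}"
    and phi_refl_K: "x \<in> gt_index F \<Longrightarrow> gt_K F x x = {\<one>\<^bsub>gt_group F x\<^esub>}"
    and phi_refl: "\<lbrakk>x \<in> gt_index F; \<xi> \<in> rcosets\<^bsub>gt_group F x\<^esub> {\<one>\<^bsub>gt_group F x\<^esub>}\<rbrakk>
      \<Longrightarrow> gt_phi F x x \<xi> = \<xi>"
    and H_sym: "(x, y) \<in> gt_eqv F \<Longrightarrow> gt_H F y x = gt_K F x y"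
    and K_sym: "(x, y) \<in> gt_eqv F \<Longrightarrow> gt_K F y x = gt_H F x y"
    and phi_sym: "\<lbrakk>(x, y) \<in> gt_eqv F; \<eta> \<in> rcosets\<^bsub>gt_group F y\<^esub> gt_K F x y\<rbrakk>
      \<Longrightarrow> gt_phi F y x \<eta> = gt_phi_inv F x y \<eta>"
    and phi_HH: "\<lbrakk>(x, y) \<in> gt_eqv F; (y, z) \<in> gt_eqv F\<rbrakk>
      \<Longrightarrow> gt_image F x y (gt_H F x y <#>\<^bsub>gt_group F x\<^esub> gt_H F x z)
        = gt_K F x y <#>\<^bsub>gt_group F y\<^esub> gt_H F y z"
    and phi_comp: "\<lbrakk>(x, y) \<in> gt_eqv F; (y, z) \<in> gt_eqv F;
        Q = gt_group F x Mod (gt_H F x y <#>\<^bsub>gt_group F x\<^esub> gt_H F x z); D \<in> carrier Q\<rbrakk>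
      \<Longrightarrow> gt_image F y z (gt_image F x y D)
        = gt_image F x z (inv\<^bsub>Q\<^esub> (gt_C F x y z) \<otimes>\<^bsub>Q\<^esub> D \<otimes>\<^bsub>Q\<^esub> gt_C F x y z)"


section \<open>The algebra of a semi-frame\<close>

definition gt_R :: "('i, 'g) group_triple \<Rightarrow> 'i \<Rightarrow> 'i \<Rightarrow> 'g set \<Rightarrow> ('g \<times> 'g) set" where
  "gt_R F x y \<alpha> = (\<Union>\<xi> \<in> rcosets\<^bsub>gt_group F x\<^esub> gt_H F x y.
     \<xi> \<times> (gt_phi F x y \<xi> <#>\<^bsub>gt_group F y\<^esub> gt_phi F x y \<alpha>))"

definition gt_Rs :: "('i, 'g) group_triple \<Rightarrow> ('g \<times> 'g) set set" where
  "gt_Rs F = {gt_R F x y \<alpha> | x y \<alpha>.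
     (x, y) \<in> gt_eqv F \<and> \<alpha> \<in> rcosets\<^bsub>gt_group F x\<^esub> gt_H F x y}"

text \<open>The product of \<open>gt_R F x y \<alpha>\<close> and \<open>gt_R F y z \<beta>\<close>.\<close>

definition gt_R_mult ::
    "('i, 'g) group_triple \<Rightarrow> 'i \<Rightarrow> 'i \<Rightarrow> 'i \<Rightarrow> 'g set \<Rightarrow> 'g set \<Rightarrow> ('g \<times> 'g) set" where
  "gt_R_mult F x y z \<alpha> \<beta> = \<Union> {gt_R F x z \<gamma> | \<gamma>.
     \<gamma> \<in> rcosets\<^bsub>gt_group F x\<^esub> gt_H F x z \<and>
     \<gamma> \<subseteq> gt_inv_image F x y (gt_phi F x y \<alpha> <#>\<^bsub>gt_group F y\<^esub> \<beta>) <#>\<^bsub>gt_group F x\<^esub> gt_C F x y z}"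

text \<open>
  Its completely distributive extension. The relations in \<open>gt_Rs F\<close> are nonempty and pairwise
  disjoint, so those included in a union of some of them are exactly the ones forming the union.
  Pairs \<open>gt_R F x y \<alpha>\<close>, \<open>gt_R F w z \<beta>\<close> with \<open>y \<noteq> w\<close> contribute nothing.
\<close>

definition gt_mult ::
    "('i, 'g) group_triple \<Rightarrow> ('g \<times> 'g) set \<Rightarrow> ('g \<times> 'g) set \<Rightarrow> ('g \<times> 'g) set" where
  "gt_mult F X Y = \<Union> {gt_R_mult F x y z \<alpha> \<beta> | x y z \<alpha> \<beta>.
     (x, y) \<in> gt_eqv F \<and> \<alpha> \<in> rcosets\<^bsub>gt_group F x\<^esub> gt_H F x y \<and> gt_R F x y \<alpha> \<subseteq> X \<and>
     (y, z) \<in> gt_eqv F \<and> \<beta> \<in> rcosets\<^bsub>gt_group F y\<^esub> gt_H F y z \<and> gt_R F y z \<beta> \<subseteq> Y}"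

definition gt_algebra :: "('i, 'g) group_triple \<Rightarrow> ('g \<times> 'g) set rel_alg" where
  "gt_algebra F =
     \<lparr>carrier = {\<Union> S | S. S \<subseteq> gt_Rs F},
      ra_join = (\<union>),
      ra_compl = (\<lambda>X. (\<Union>(x, y) \<in> gt_eqv F.
        carrier (gt_group F x) \<times> carrier (gt_group F y)) - X),
      ra_comp = gt_mult F,
      ra_conv = converse,
      ra_id = Id_on (\<Union>x \<in> gt_index F. carrier (gt_group F x))\<rparr>"

definition coset_relation_algebra :: "('i, 'g) group_triple \<Rightarrow> bool" where
  "coset_relation_algebra F \<longleftrightarrow> semi_frame F \<and> relation_algebra (gt_algebra F)"

end

theory Submission
  imports Defs "HOL-Algebra.SndIsomorphismGrp"
begin

text \<open>
  Every atomic relation algebra \<open>B\<close> embeds densely into the complex algebra of its atoms, and any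
  completion of \<open>B\<close> is isomorphic to that algebra, because by the cycle laws a relative product is
  determined by the products of the atoms below its factors.

  If \<open>B\<close> is measurable, the atoms form a category-like structure in which \<open>a ; b\<close> may consist of
  several atoms: each atom runs from one subidentity atom \<open>x\<close> to another one \<open>y\<close>. Measurability says
  that atoms from \<open>x\<close> to \<open>x\<close> are functions, so they form a group \<open>G\<^sub>x\<close> and multiplying by them is
  single-valued. The set of atoms from \<open>x\<close> to \<open>y\<close> carries commuting transitive actions of \<open>G\<^sub>x\<close> on
  the left and \<open>G\<^sub>y\<close> on the right. Choosing a base atom \<open>a\<^sub>x\<^sub>y\<close> in each of these sets, with
  \<open>a\<^sub>x\<^sub>x = x\<close> and \<open>a\<^sub>y\<^sub>x\<close> the converse of \<open>a\<^sub>x\<^sub>y\<close>, gives the frame: \<open>H\<^sub>x\<^sub>y\<close> and \<open>K\<^sub>x\<^sub>y\<close> are the stabilizers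
  of \<open>a\<^sub>x\<^sub>y\<close>, the isomorphism \<open>\<phi>\<^sub>x\<^sub>y\<close> is read off from \<open>g ; a\<^sub>x\<^sub>y = a\<^sub>x\<^sub>y ; k\<close>, and \<open>C\<^sub>x\<^sub>y\<^sub>z\<close> measures the
  failure of \<open>a\<^sub>x\<^sub>y ; a\<^sub>y\<^sub>z\<close> to be \<open>a\<^sub>x\<^sub>z\<close>. A set \<open>X\<close> of atoms corresponds to the relation consisting
  of the pairs \<open>(g, k)\<close> with \<open>g\<^sup>-\<^sup>1 ; a\<^sub>x\<^sub>y ; k \<in> X\<close>.
\<close>

section \<open>Boolean part and cycle laws\<close>

context boolean_part
begin

abbreviation meet (infixl \<open>\<triangle>\<close> 70) where "a \<triangle> b \<equiv> ra_meet A a b"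
abbreviation zero (\<open>\<zero>\<^sub>A\<close>) where "\<zero>\<^sub>A \<equiv> ra_zero A"
abbreviation one (\<open>\<one>\<^sub>A\<close>) where "\<one>\<^sub>A \<equiv> ra_one A"
abbreviation le (infix \<open>\<preceq>\<close> 50) where "a \<preceq> b \<equiv> ra_le A a b"

lemma one_closed: "\<one>\<^sub>A \<in> carrier A"
  by (simp add: ra_one_def compl_closed zero_closed)

lemma meet_closed: "\<lbrakk>a \<in> carrier A; b \<in> carrier A\<rbrakk> \<Longrightarrow> a \<triangle> b \<in> carrier A"
  by (simp add: ra_meet_def compl_closed join_closed)

lemmas bool_closed = join_closed compl_closed zero_closed one_closed meet_closed

text \<open>Distributing \<open>b\<close> over \<open>a \<uplus> \<sim> a\<close> and
  \<open>\<sim> a\<close> over \<open>a \<uplus> b\<close> leaves the same meet of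
  \<open>\<sim> a\<close> and \<open>b\<close>. Double negation, and with it De Morgan, rests on
  this, since meet is defined through complement.\<close>

lemma compl_unique:
  assumes "a \<in> carrier A" "b \<in> carrier A" "a \<uplus> b = \<one>\<^sub>A" "a \<triangle> b = \<zero>\<^sub>A"
  shows "b = \<sim> a"
proof -
  have "b = b \<triangle> (a \<uplus> \<sim> a)"
    using assms by (simp add: join_compl meet_one)
  also have "\<dots> = \<zero>\<^sub>A \<uplus> b \<triangle> \<sim> a"
    using assms by (simp add: meet_join_distrib bool_closed meet_commute[of b a])
  also have "\<dots> = \<sim> a \<triangle> a \<uplus> \<sim> a \<triangle> b"
    using assms by (simp add: bool_closed meet_commute[of b "\<sim> a"] meet_commute[of "\<sim> a" a] meet_compl)
  also have "\<dots> = \<sim> a \<triangle> (a \<uplus> b)"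
    using assms by (metis meet_join_distrib compl_closed)
  also have "\<dots> = \<sim> a"
    using assms by (simp add: meet_one bool_closed)
  finally show ?thesis .
qed

lemma compl_compl: "a \<in> carrier A \<Longrightarrow> \<sim> (\<sim> a) = a"
  by (rule compl_unique[symmetric])
    (simp_all add: bool_closed join_commute[of "\<sim> a"] meet_commute[of "\<sim> a"] join_compl meet_compl)

lemma join_idem: "a \<in> carrier A \<Longrightarrow> a \<uplus> a = a"
  using join_meet_distrib[of a a "\<sim> a"]
  by (simp add: bool_closed join_compl meet_compl meet_one join_zero)

lemma join_one: "a \<in> carrier A \<Longrightarrow> a \<uplus> \<one>\<^sub>A = \<one>\<^sub>A"
  using join_assoc[of a a "\<sim> a"] by (simp add: bool_closed join_compl join_idem)

lemma meet_zero: "a \<in> carrier A \<Longrightarrow> a \<triangle> \<zero>\<^sub>A = \<zero>\<^sub>A"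
  using join_one[of "\<sim> a"]
  by (simp add: ra_meet_def bool_closed flip: ra_one_def) (simp add: ra_one_def compl_compl zero_closed)

lemma compl_meet: "\<lbrakk>a \<in> carrier A; b \<in> carrier A\<rbrakk> \<Longrightarrow> \<sim> (a \<triangle> b) = \<sim> a \<uplus> \<sim> b"
  by (simp add: ra_meet_def compl_compl bool_closed)

lemma join_absorb: "\<lbrakk>a \<in> carrier A; b \<in> carrier A\<rbrakk> \<Longrightarrow> a \<uplus> a \<triangle> b = a"
  using meet_join_distrib[of a "\<one>\<^sub>A" b]
  by (simp add: bool_closed meet_one join_one join_commute[of "\<one>\<^sub>A" b])

lemma meet_absorb: "\<lbrakk>a \<in> carrier A; b \<in> carrier A\<rbrakk> \<Longrightarrow> a \<triangle> (a \<uplus> b) = a"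
  using join_meet_distrib[of a "\<zero>\<^sub>A" b]
  by (simp add: bool_closed join_zero meet_zero meet_commute[of "\<zero>\<^sub>A" b])

lemma le_iff_meet: "\<lbrakk>a \<in> carrier A; b \<in> carrier A\<rbrakk> \<Longrightarrow> a \<preceq> b \<longleftrightarrow> a \<triangle> b = a"
  unfolding ra_le_def
  by (metis join_absorb join_commute meet_absorb meet_commute meet_closed)

lemma le_refl: "a \<in> carrier A \<Longrightarrow> a \<preceq> a"
  by (simp add: ra_le_def join_idem)

lemma le_antisym: "\<lbrakk>a \<preceq> b; b \<preceq> a; a \<in> carrier A; b \<in> carrier A\<rbrakk> \<Longrightarrow> a = b"
  by (metis ra_le_def join_commute)

lemma le_trans:
  "\<lbrakk>a \<preceq> b; b \<preceq> c; a \<in> carrier A; b \<in> carrier A; c \<in> carrier A\<rbrakk> \<Longrightarrow> a \<preceq> c"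
  unfolding ra_le_def by (metis join_assoc)

lemma zero_le: "a \<in> carrier A \<Longrightarrow> \<zero>\<^sub>A \<preceq> a"
  by (simp add: ra_le_def join_commute[of "\<zero>\<^sub>A"] zero_closed join_zero)

lemma le_one: "a \<in> carrier A \<Longrightarrow> a \<preceq> \<one>\<^sub>A"
  by (simp add: ra_le_def join_one)

lemma le_zero_iff: "a \<in> carrier A \<Longrightarrow> a \<preceq> \<zero>\<^sub>A \<longleftrightarrow> a = \<zero>\<^sub>A"
  by (simp add: ra_le_def join_zero)

lemma le_meet_iff:
  assumes "a \<in> carrier A" "b \<in> carrier A" "c \<in> carrier A"
  shows "c \<preceq> a \<triangle> b \<longleftrightarrow> c \<preceq> a \<and> c \<preceq> b"
proof
  assume *: "c \<preceq> a \<triangle> b"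
  have "a \<triangle> b \<preceq> a"
    using assms by (simp add: ra_le_def join_absorb join_commute[of "a \<triangle> b"] meet_closed)
  moreover have "b \<triangle> a \<preceq> b"
    using assms by (simp add: ra_le_def join_absorb join_commute[of "b \<triangle> a"] meet_closed)
  ultimately show "c \<preceq> a \<and> c \<preceq> b"
    using * assms by (metis le_trans meet_closed meet_commute)
next
  assume "c \<preceq> a \<and> c \<preceq> b"
  then show "c \<preceq> a \<triangle> b"
    using assms join_meet_distrib[of c a b] join_commute by (auto simp: ra_le_def)
qed

lemma meet_le1: "\<lbrakk>a \<in> carrier A; b \<in> carrier A\<rbrakk> \<Longrightarrow> a \<triangle> b \<preceq> a"
  and meet_le2: "\<lbrakk>a \<in> carrier A; b \<in> carrier A\<rbrakk> \<Longrightarrow> a \<triangle> b \<preceq> b"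
  using le_meet_iff le_refl meet_closed by blast+

lemma meet_idem: "a \<in> carrier A \<Longrightarrow> a \<triangle> a = a"
  using le_iff_meet le_refl by blast

lemma le_compl_iff:
  assumes "a \<in> carrier A" "b \<in> carrier A"
  shows "a \<preceq> \<sim> b \<longleftrightarrow> a \<triangle> b = \<zero>\<^sub>A"
proof
  assume "a \<preceq> \<sim> b"
  then have "a = a \<triangle> \<sim> b"
    using assms by (simp add: le_iff_meet bool_closed)
  then have "a \<triangle> b = a \<triangle> (\<sim> b \<triangle> b)"
    using assms by (metis meet_assoc compl_closed)
  then show "a \<triangle> b = \<zero>\<^sub>A"
    using assms by (simp add: meet_commute[of "\<sim> b"] meet_compl meet_zero bool_closed)
next
  assume "a \<triangle> b = \<zero>\<^sub>A"
  then have "a \<triangle> \<sim> b = a"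
    using assms meet_join_distrib[of a "\<sim> b" b]
    by (simp add: bool_closed join_commute[of "\<sim> b"] join_compl join_zero meet_one)
  then show "a \<preceq> \<sim> b"
    using assms by (simp add: le_iff_meet bool_closed)
qed

lemma le_iff_disjoint_compl:
  "\<lbrakk>a \<in> carrier A; b \<in> carrier A\<rbrakk> \<Longrightarrow> a \<preceq> b \<longleftrightarrow> a \<triangle> \<sim> b = \<zero>\<^sub>A"
  using le_compl_iff[of a "\<sim> b"] by (simp add: bool_closed compl_compl)

section \<open>Atoms as prime elements\<close>

lemma atom_closed: "ra_atom A x \<Longrightarrow> x \<in> carrier A"
  by (simp add: ra_atom_def)

lemma atom_le_iff:
  assumes "ra_atom A x" "a \<in> carrier A"
  shows "x \<preceq> a \<longleftrightarrow> x \<triangle> a \<noteq> \<zero>\<^sub>A"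
proof -
  have "x \<triangle> a \<preceq> x"
    using assms le_meet_iff[of x a "x \<triangle> a"] by (simp add: atom_closed meet_closed le_refl)
  then show ?thesis
    using assms by (metis ra_atom_def le_iff_meet meet_closed)
qed

lemma atom_le_compl_iff:
  "\<lbrakk>ra_atom A x; a \<in> carrier A\<rbrakk> \<Longrightarrow> x \<preceq> \<sim> a \<longleftrightarrow> \<not> x \<preceq> a"
  by (simp add: atom_le_iff le_compl_iff atom_closed)

lemma atom_le_join_iff:
  "\<lbrakk>ra_atom A x; a \<in> carrier A; b \<in> carrier A\<rbrakk> \<Longrightarrow> x \<preceq> a \<uplus> b \<longleftrightarrow> x \<preceq> a \<or> x \<preceq> b"
  using atom_le_compl_iff[of x "\<sim> a \<triangle> \<sim> b"]
  by (simp add: compl_meet compl_compl bool_closed le_meet_iff atom_closed atom_le_compl_iff)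

lemma atoms_eq: "\<lbrakk>ra_atom A x; ra_atom A y; x \<preceq> y\<rbrakk> \<Longrightarrow> x = y"
  unfolding ra_atom_def by blast

text \<open>Complete primeness: were \<open>x\<close> below no member of \<open>S\<close>, its
  complement would be an upper bound of \<open>S\<close>, hence lie above \<open>a\<close> and above
  \<open>x\<close> itself.\<close>

lemma atom_le_sup:
  assumes "ra_atom A x" "ra_is_sup A S a" "x \<preceq> a"
  shows "\<exists>s\<in>S. x \<preceq> s"
proof (rule ccontr)
  assume no: "\<not> ?thesis"
  have S: "S \<subseteq> carrier A" and a: "a \<in> carrier A"
    and up: "\<And>u. u \<in> carrier A \<Longrightarrow> (\<And>s. s \<in> S \<Longrightarrow> s \<preceq> u) \<Longrightarrow> a \<preceq> u"
    using assms by (auto simp: ra_is_sup_def least_def Upper_def ra_order_def)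
  have "s \<preceq> \<sim> x" if "s \<in> S" for s
    using no that S assms
    by (metis atom_closed atom_le_iff le_compl_iff meet_commute subsetD)
  then have "a \<preceq> \<sim> x"
    using assms by (intro up) (simp_all add: bool_closed atom_closed)
  then have "x \<preceq> \<sim> x"
    using assms a by (metis le_trans atom_closed compl_closed)
  then show False
    using assms by (metis atom_closed atom_le_compl_iff le_refl)
qed

end

section \<open>Monotony, converse and the cycle laws\<close>

context relation_algebra
begin

text \<open>The axiom distributes sums in the left factor; taking converses exchanges the
  factors.\<close>

lemma comp_join_distrib:
  assumes "r \<in> carrier A" "s \<in> carrier A" "t \<in> carrier A"
  shows "r ;; (s \<uplus> t) = r ;; s \<uplus> r ;; t"
proof -
  have "conv (r ;; (s \<uplus> t)) = conv (r ;; s \<uplus> r ;; t)"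
    using assms by (simp add: conv_comp conv_join join_comp_distrib comp_closed conv_closed join_closed)
  then show ?thesis
    using assms by (metis conv_conv comp_closed join_closed)
qed

lemma conv_mono: "\<lbrakk>r \<preceq> s; r \<in> carrier A; s \<in> carrier A\<rbrakk> \<Longrightarrow> conv r \<preceq> conv s"
  unfolding ra_le_def by (metis conv_join)

lemma conv_le_iff: "\<lbrakk>r \<in> carrier A; s \<in> carrier A\<rbrakk> \<Longrightarrow> conv r \<preceq> s \<longleftrightarrow> r \<preceq> conv s"
  by (metis conv_closed conv_conv conv_mono)

lemma comp_mono:
  assumes "r \<preceq> r'" "s \<preceq> s'"
    and "r \<in> carrier A" "r' \<in> carrier A" "s \<in> carrier A" "s' \<in> carrier A"
  shows "r ;; s \<preceq> r' ;; s'"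
proof -
  have "r ;; s \<preceq> r' ;; s"
    using assms unfolding ra_le_def by (metis join_comp_distrib)
  moreover have "r' ;; s \<preceq> r' ;; s'"
    using assms unfolding ra_le_def by (metis comp_join_distrib)
  ultimately show ?thesis
    using assms by (metis le_trans comp_closed)
qed

text \<open>Tarski's axiom in disjointness form: \<open>t\<close> lies below
  \<open>\<sim> (r ;; s)\<close>, so monotony puts \<open>conv r ;; t\<close> below
  \<open>conv r ;; \<sim> (r ;; s)\<close>, and the axiom puts that below
  \<open>\<sim> s\<close>.\<close>

lemma cycle_left_imp:
  assumes "r \<in> carrier A" "s \<in> carrier A" "t \<in> carrier A" "(r ;; s) \<triangle> t = \<zero>\<^sub>A"
  shows "(conv r ;; t) \<triangle> s = \<zero>\<^sub>A"
proof -
  have "t \<preceq> \<sim> (r ;; s)"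
    using assms by (simp add: le_compl_iff comp_closed meet_commute)
  then have "conv r ;; t \<preceq> conv r ;; \<sim> (r ;; s)"
    using assms by (simp add: comp_mono le_refl conv_closed comp_closed compl_closed)
  moreover have "conv r ;; \<sim> (r ;; s) \<preceq> \<sim> s"
    using assms by (simp add: ra_le_def tarski)
  ultimately have "conv r ;; t \<preceq> \<sim> s"
    using assms le_trans by (metis conv_closed comp_closed compl_closed)
  then show ?thesis
    using assms by (simp add: le_compl_iff conv_closed comp_closed)
qed

lemma cycle_left:
  assumes "r \<in> carrier A" "s \<in> carrier A" "t \<in> carrier A"
  shows "(r ;; s) \<triangle> t = \<zero>\<^sub>A \<longleftrightarrow> (conv r ;; t) \<triangle> s = \<zero>\<^sub>A"
  using cycle_left_imp[of r s t] cycle_left_imp[of "conv r" t s] assms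
  by (auto simp: conv_conv conv_closed)

lemma disjoint_conv_iff:
  assumes "r \<in> carrier A" "s \<in> carrier A"
  shows "conv r \<triangle> conv s = \<zero>\<^sub>A \<longleftrightarrow> r \<triangle> s = \<zero>\<^sub>A"
proof -
  have *: "u \<triangle> v = \<zero>\<^sub>A" if "conv u \<triangle> conv v = \<zero>\<^sub>A" "u \<in> carrier A" "v \<in> carrier A" for u v
  proof -
    have "conv (u \<triangle> v) \<preceq> conv u \<triangle> conv v"
      using that(2,3) by (simp add: le_meet_iff conv_mono conv_closed meet_closed meet_le1 meet_le2)
    then have "u \<triangle> v \<preceq> conv \<zero>\<^sub>A"
      using that by (simp add: conv_le_iff meet_closed zero_closed)
    \<comment> \<open>Moving the converse to the other side turns this into a lower bound by
      zero.\<close>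
    moreover have "conv \<zero>\<^sub>A \<preceq> \<zero>\<^sub>A"
      by (simp add: conv_le_iff zero_closed zero_le conv_closed)
    ultimately show ?thesis
      using that by (metis le_trans le_zero_iff conv_closed zero_closed meet_closed)
  qed
  show ?thesis
    using * assms *[of "conv r" "conv s"] by (auto simp: conv_closed conv_conv)
qed

text \<open>The mirror image of \<open>cycle_left\<close>, obtained by taking converses before and
  after.\<close>

lemma cycle_right:
  assumes "r \<in> carrier A" "s \<in> carrier A" "t \<in> carrier A"
  shows "(r ;; s) \<triangle> t = \<zero>\<^sub>A \<longleftrightarrow> (t ;; conv s) \<triangle> r = \<zero>\<^sub>A"
proof -
  have "(r ;; s) \<triangle> t = \<zero>\<^sub>A \<longleftrightarrow> (conv s ;; conv r) \<triangle> conv t = \<zero>\<^sub>A"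
    using assms disjoint_conv_iff[of "r ;; s" t] by (simp add: conv_comp comp_closed)
  also have "\<dots> \<longleftrightarrow> (s ;; conv t) \<triangle> conv r = \<zero>\<^sub>A"
    using assms cycle_left[of "conv s" "conv r" "conv t"] by (simp add: conv_conv conv_closed)
  also have "\<dots> \<longleftrightarrow> (t ;; conv s) \<triangle> r = \<zero>\<^sub>A"
    using assms disjoint_conv_iff[of "t ;; conv s" r]
    by (simp add: conv_comp conv_conv comp_closed conv_closed)
  finally show ?thesis .
qed

lemma atom_conv: "ra_atom A x \<Longrightarrow> ra_atom A (conv x)"
  unfolding ra_atom_def
  by (metis conv_closed conv_conv conv_le_iff disjoint_conv_iff meet_idem zero_closed)

end

section \<open>Complex algebras of atom structures\<close>

text \<open>\<open>T a b c\<close> abstracts \<open>c \<le> a ; b\<close> for atoms, and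
  \<open>J\<close> the atoms below the identity. Cycling and reversal generate all Peircean
  transforms of a triangle; reversal also supplies the other half of associativity and the left
  identity laws.\<close>

locale atom_structure =
  fixes At :: "'a set" and T :: "'a \<Rightarrow> 'a \<Rightarrow> 'a \<Rightarrow> bool" and cv :: "'a \<Rightarrow> 'a" and J :: "'a set"
  assumes T_closed: "T a b c \<Longrightarrow> a \<in> At \<and> b \<in> At \<and> c \<in> At"
    and cv_closed: "a \<in> At \<Longrightarrow> cv a \<in> At"
    and cv_cv: "a \<in> At \<Longrightarrow> cv (cv a) = a"
    and J_closed: "i \<in> J \<Longrightarrow> i \<in> At"
    and T_cycle: "T a b c \<Longrightarrow> T (cv a) c b"
    and T_cv: "T a b c \<Longrightarrow> T (cv b) (cv a) (cv c)"
    and T_assoc: "\<lbrakk>T a b u; T u c e\<rbrakk> \<Longrightarrow> \<exists>v. T b c v \<and> T a v e"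
    and T_right_id_ex: "a \<in> At \<Longrightarrow> \<exists>i\<in>J. T a i a"
    and T_right_id: "\<lbrakk>T a i b; i \<in> J\<rbrakk> \<Longrightarrow> a = b"
begin

lemma T_cycle': "T a b c \<Longrightarrow> T c (cv b) a"
  by (metis T_closed T_cv T_cycle cv_cv)

lemma T_assoc': "\<lbrakk>T b c v; T a v e\<rbrakk> \<Longrightarrow> \<exists>u. T a b u \<and> T u c e"
  using T_assoc[OF T_cv T_cv] T_cv T_closed cv_cv by metis

text \<open>A right identity \<open>j\<close> of \<open>cv i\<close> satisfies
  \<open>cv j = i\<close> after reversal of its triangle; cycling the reversed triangle gives
  \<open>j = i\<close>.\<close>

lemma cv_J:
  assumes "i \<in> J"
  shows "cv i = i"
proof -
  obtain j where j: "j \<in> J" "T (cv i) j (cv i)"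
    using T_right_id_ex J_closed cv_closed assms by blast
  then have "T (cv j) i i"
    by (metis T_cv assms J_closed cv_cv)
  then have "cv j = i"
    using T_right_id assms by blast
  then show ?thesis
    by (metis \<open>T (cv j) i i\<close> j T_cycle T_right_id J_closed cv_cv)
qed

lemma T_left_id_ex: "a \<in> At \<Longrightarrow> \<exists>i\<in>J. T i a a"
  by (metis T_right_id_ex T_cv cv_J cv_closed cv_cv)

lemma T_left_id: "\<lbrakk>T i a b; i \<in> J\<rbrakk> \<Longrightarrow> a = b"
  by (metis T_right_id T_cv cv_J T_closed cv_cv)

end

section \<open>The full complex algebra\<close>

definition complex_algebra ::
  "'a set \<Rightarrow> ('a \<Rightarrow> 'a \<Rightarrow> 'a \<Rightarrow> bool) \<Rightarrow> ('a \<Rightarrow> 'a) \<Rightarrow> 'a set \<Rightarrow> 'a set rel_alg" where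
  "complex_algebra At T cv J =
     \<lparr>carrier = Pow At,
      ra_join = (\<union>),
      ra_compl = (\<lambda>X. At - X),
      ra_comp = (\<lambda>X Y. {c. \<exists>a\<in>X. \<exists>b\<in>Y. T a b c}),
      ra_conv = image cv,
      ra_id = J\<rparr>"

lemma complex_algebra_simps [simp]:
  "carrier (complex_algebra At T cv J) = Pow At"
  "ra_join (complex_algebra At T cv J) = (\<union>)"
  "ra_compl (complex_algebra At T cv J) = (\<lambda>X. At - X)"
  "ra_comp (complex_algebra At T cv J) = (\<lambda>X Y. {c. \<exists>a\<in>X. \<exists>b\<in>Y. T a b c})"
  "ra_conv (complex_algebra At T cv J) = image cv"
  "ra_id (complex_algebra At T cv J) = J"
  by (simp_all add: complex_algebra_def)

lemma ra_zero_complex_algebra [simp]: "ra_zero (complex_algebra At T cv J) = {}"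
  unfolding ra_zero_def by (rule the_equality) auto

lemma ra_one_complex_algebra [simp]: "ra_one (complex_algebra At T cv J) = At"
  by (simp add: ra_one_def)

lemma ra_meet_complex_algebra [simp]:
  "\<lbrakk>X \<subseteq> At; Y \<subseteq> At\<rbrakk> \<Longrightarrow> ra_meet (complex_algebra At T cv J) X Y = X \<inter> Y"
  by (auto simp: ra_meet_def)

lemma ra_le_complex_algebra [simp]: "ra_le (complex_algebra At T cv J) X Y \<longleftrightarrow> X \<subseteq> Y"
  by (auto simp: ra_le_def)

lemma ra_complete_complex_algebra: "ra_complete (complex_algebra At T cv J)"
proof -
  have "ra_order (complex_algebra At T cv J) = \<lparr>carrier = Pow At, eq = (=), le = (\<subseteq>)\<rparr>"
    by (simp add: ra_order_def fun_eq_iff)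
  then show ?thesis
    by (simp add: ra_complete_def powerset_is_complete_lattice)
qed

context atom_structure
begin

lemma complex_comp_assoc:
  "{d. \<exists>a\<in>X. \<exists>u\<in>{u. \<exists>b\<in>Y. \<exists>c\<in>Z. T b c u}. T a u d} =
   {d. \<exists>u\<in>{u. \<exists>a\<in>X. \<exists>b\<in>Y. T a b u}. \<exists>c\<in>Z. T u c d}"
  by (auto; metis T_assoc T_assoc')

lemma complex_comp_conv:
  assumes "X \<subseteq> At" "Y \<subseteq> At"
  shows "cv ` {c. \<exists>a\<in>X. \<exists>b\<in>Y. T a b c} = {c. \<exists>a\<in>cv ` Y. \<exists>b\<in>cv ` X. T a b c}"
proof -
  have "c \<in> cv ` {c. \<exists>a\<in>X. \<exists>b\<in>Y. T a b c}" if "b \<in> Y" "a \<in> X" "T (cv b) (cv a) c" for a b c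
    using that assms T_cv[OF that(3)] T_closed[OF that(3)]
    by (intro image_eqI[of _ _ "cv c"]) (auto simp: cv_cv subset_iff)
  then show ?thesis
    by (auto intro: T_cv)
qed

text \<open>Cycling in contrapositive form: from \<open>T (cv a) b c\<close> with
  \<open>c \<in> Y\<close> follows \<open>T a c b\<close>, so \<open>b\<close> belongs to the
  product of \<open>X\<close> and \<open>Y\<close>.\<close>

lemma complex_tarski:
  "{c. \<exists>a\<in>cv ` X. \<exists>b\<in>At - {c. \<exists>a\<in>X. \<exists>b\<in>Y. T a b c}. T a b c} \<subseteq> At - Y" if "X \<subseteq> At"
  using that by auto (metis T_closed, metis T_cycle cv_cv subsetD)

theorem relation_algebra_complex_algebra: "relation_algebra (complex_algebra At T cv J)"
proof (unfold_locales, goal_cases)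
  \<comment> \<open>The cases treated separately are closure of composition, associativity, right
    identity, involution, converse of a product, Tarski's axiom and, last, associativity of
    meet.\<close>
  case (14 r s) then show ?case using T_closed by auto
next
  case 17 then show ?case by (simp only: complex_algebra_simps complex_comp_assoc)
next
  case (18 r)
  then show ?case by (auto dest: T_right_id) (metis T_right_id_ex subsetD T_right_id)
next
  case (19 r)
  then show ?case by (auto simp: image_image cv_cv subset_iff)
next
  case (20 r s)
  then show ?case by (simp add: complex_comp_conv)
next
  case (23 r s)
  then show ?case 
    using complex_tarski[of r s] by (simp only: complex_algebra_simps Pow_iff subset_Un_eq)
next
  case (6 a b c)
  then show ?case by (auto simp: ra_meet_def)
qed (use J_closed cv_closed in auto)

end

definition atom_algebra :: "('a, 'm) rel_alg_scheme \<Rightarrow> 'a set rel_alg" where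
  "atom_algebra B = complex_algebra {x. ra_atom B x}
     (\<lambda>a b c. ra_atom B a \<and> ra_atom B b \<and> ra_atom B c \<and> ra_le B c (a ;;\<^bsub>B\<^esub> b))
     (ra_conv B) {x. ra_atom B x \<and> ra_le B x \<iota>\<^bsub>B\<^esub>}"

section \<open>Completions of atomic relation algebras\<close>

context relation_algebra
begin

text \<open>The useful direction gives a nonzero meet: an atom below it can replace the factor
  \<open>s\<close>.\<close>

lemma atom_le_comp_left:
  assumes "ra_atom A x" "r \<in> carrier A" "s \<in> carrier A"
  shows "x \<preceq> r ;; s \<longleftrightarrow> (conv r ;; x) \<triangle> s \<noteq> \<zero>\<^sub>A"
  using assms cycle_left[of r s x] by (simp add: atom_le_iff atom_closed comp_closed meet_commute)

lemma atom_le_comp_right: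
  assumes "ra_atom A x" "r \<in> carrier A" "s \<in> carrier A"
  shows "x \<preceq> r ;; s \<longleftrightarrow> (x ;; conv s) \<triangle> r \<noteq> \<zero>\<^sub>A"
  using assms cycle_right[of r s x] by (simp add: atom_le_iff atom_closed comp_closed meet_commute)

lemma atom_cycle_left:
  assumes "ra_atom A x" "ra_atom A y" "r \<in> carrier A"
  shows "x \<preceq> r ;; y \<longleftrightarrow> y \<preceq> conv r ;; x"
  using assms atom_le_comp_left[of x r y] atom_le_iff[of y "conv r ;; x"]
  by (simp add: atom_closed comp_closed conv_closed meet_commute)

lemma atom_cycle_right:
  assumes "ra_atom A x" "ra_atom A y" "r \<in> carrier A"
  shows "x \<preceq> y ;; r \<longleftrightarrow> y \<preceq> x ;; conv r"
  using assms atom_le_comp_right[of x y r] atom_le_iff[of y "x ;; conv r"]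
  by (simp add: atom_closed comp_closed conv_closed meet_commute)

end

text \<open>Covers both a completion of \<open>B\<close> and, with the identity map,
  \<open>B\<close> itself, so that the analysis of composition by atoms serves for both.\<close>

locale dense_embedding = A: relation_algebra A + B: relation_algebra B
  for A :: "('a, 'm) rel_alg_scheme" and B :: "('b, 'n) rel_alg_scheme" +
  fixes e :: "'b \<Rightarrow> 'a"
  assumes hom: "e \<in> ra_hom B A"
    and inj: "inj_on e (carrier B)"
    and dense: "\<lbrakk>a \<in> carrier A; a \<noteq> ra_zero A\<rbrakk>
      \<Longrightarrow> \<exists>b\<in>carrier B. b \<noteq> ra_zero B \<and> ra_le A (e b) a"
    and atomic: "ra_atomic B"
begin

lemma e_closed: "b \<in> carrier B \<Longrightarrow> e b \<in> carrier A"
  using hom by (auto simp: ra_hom_def)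

lemma e_join: "\<lbrakk>b \<in> carrier B; c \<in> carrier B\<rbrakk> \<Longrightarrow> e (b \<uplus>\<^bsub>B\<^esub> c) = e b \<uplus>\<^bsub>A\<^esub> e c"
  and e_compl: "b \<in> carrier B \<Longrightarrow> e (\<sim>\<^bsub>B\<^esub> b) = \<sim>\<^bsub>A\<^esub> e b"
  and e_comp: "\<lbrakk>b \<in> carrier B; c \<in> carrier B\<rbrakk> \<Longrightarrow> e (b ;;\<^bsub>B\<^esub> c) = e b ;;\<^bsub>A\<^esub> e c"
  and e_conv: "b \<in> carrier B \<Longrightarrow> e (conv\<^bsub>B\<^esub> b) = conv\<^bsub>A\<^esub> e b"
  and e_id: "e \<iota>\<^bsub>B\<^esub> = \<iota>\<^bsub>A\<^esub>"
  using hom by (auto simp: ra_hom_def)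

lemma e_meet:
  "\<lbrakk>b \<in> carrier B; c \<in> carrier B\<rbrakk> \<Longrightarrow> e (ra_meet B b c) = ra_meet A (e b) (e c)"
  by (simp add: ra_meet_def e_compl e_join B.bool_closed)

text \<open>Zero is not an operation of the similarity type; it is recovered as the meet of an
  element with its complement.\<close>

lemma e_zero: "e (ra_zero B) = ra_zero A"
  by (metis A.meet_compl B.meet_compl B.zero_closed B.compl_closed e_closed e_compl e_meet)

lemma e_le_iff: "\<lbrakk>b \<in> carrier B; c \<in> carrier B\<rbrakk> \<Longrightarrow> ra_le A (e b) (e c) \<longleftrightarrow> ra_le B b c"
  unfolding ra_le_def by (metis e_join inj inj_onD B.join_closed)

text \<open>Density puts some nonzero \<open>e c\<close> below a nonzero \<open>a \<le> e b\<close>;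
  then \<open>c \<le> b\<close> forces \<open>c = b\<close>, and \<open>a\<close> is squeezed to
  \<open>e b\<close>.\<close>

lemma e_atom:
  assumes "ra_atom B b"
  shows "ra_atom A (e b)"
  unfolding ra_atom_def
proof (intro conjI ballI impI)
  have b: "b \<in> carrier B" "b \<noteq> ra_zero B"
    using assms by (auto simp: ra_atom_def)
  show "e b \<in> carrier A" using b e_closed by blast
  show "e b \<noteq> ra_zero A"
    using b inj e_zero B.zero_closed by (metis inj_onD)
  fix a assume a: "a \<in> carrier A" "ra_le A a (e b)"
  show "a = ra_zero A \<or> a = e b"
  proof (rule disjCI)
    assume "a \<noteq> e b"
    show "a = ra_zero A"
    proof (rule ccontr)
      assume "a \<noteq> ra_zero A"
      then obtain c where c: "c \<in> carrier B" "c \<noteq> ra_zero B" "ra_le A (e c) a"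
        using dense a by blast
      then have "ra_le A (e c) (e b)"
        using a b by (metis A.le_trans e_closed)
      then have "c = b"
        using b c assms by (metis e_le_iff ra_atom_def)
      then show False
        using c a b \<open>a \<noteq> e b\<close> by (metis A.le_antisym e_closed)
    qed
  qed
qed

lemma atom_below:
  assumes "a \<in> carrier A" "a \<noteq> ra_zero A"
  shows "\<exists>b. ra_atom B b \<and> ra_le A (e b) a"
proof -
  obtain c where c: "c \<in> carrier B" "c \<noteq> ra_zero B" "ra_le A (e c) a"
    using dense assms by blast
  then obtain b where "ra_atom B b" "ra_le B b c"
    using atomic by (auto simp: ra_atomic_def)
  then show ?thesis
    using c assms by (metis A.le_trans e_closed e_le_iff B.atom_closed)
qed

definition atoms_below :: "'a \<Rightarrow> 'b set" where
  "atoms_below a = {b. ra_atom B b \<and> ra_le A (e b) a}"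

text \<open>Otherwise the part of \<open>a\<close> outside \<open>c\<close> is nonzero and lies
  above the image of an atom.\<close>

lemma le_if_atoms_below:
  assumes "a \<in> carrier A" "c \<in> carrier A" "atoms_below a \<subseteq> atoms_below c"
  shows "ra_le A a c"
proof (rule ccontr)
  assume "\<not> ra_le A a c"
  then have "ra_meet A a (\<sim>\<^bsub>A\<^esub> c) \<noteq> ra_zero A"
    using assms by (simp add: A.le_iff_disjoint_compl)
  then obtain b where b: "ra_atom B b" "ra_le A (e b) (ra_meet A a (\<sim>\<^bsub>A\<^esub> c))"
    using assms atom_below A.bool_closed by metis
  then have "ra_le A (e b) a" "\<not> ra_le A (e b) c"
    using assms e_atom[OF b(1)]
    by (simp_all add: A.le_meet_iff A.compl_closed A.atom_closed A.atom_le_compl_iff)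
  then show False
    using b assms by (auto simp: atoms_below_def)
qed

text \<open>Composition is determined by atoms without any appeal to infinite distributivity: the
  cycle laws allow first \<open>s\<close> and then \<open>r\<close> to be shrunk to the image of an
  atom while the product stays above \<open>e b\<close>.\<close>

lemma e_le_comp_iff:
  assumes "ra_atom B b" "r \<in> carrier A" "s \<in> carrier A"
  shows "ra_le A (e b) (r ;;\<^bsub>A\<^esub> s) \<longleftrightarrow>
    (\<exists>c\<in>atoms_below r. \<exists>d\<in>atoms_below s. ra_le B b (c ;;\<^bsub>B\<^esub> d))"
proof
  note eb = e_atom[OF assms(1)] and eb' = A.atom_closed[OF e_atom[OF assms(1)]]
  assume "ra_le A (e b) (r ;;\<^bsub>A\<^esub> s)"
  \<comment> \<open>The left cycle law makes this meet nonzero, so it contains the image of an atom,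
    the new right factor.\<close>
  then obtain d where d: "ra_atom B d" "ra_le A (e d) (ra_meet A (conv\<^bsub>A\<^esub> r ;;\<^bsub>A\<^esub> e b) s)"
    using atom_below[of "ra_meet A (conv\<^bsub>A\<^esub> r ;;\<^bsub>A\<^esub> e b) s"] assms eb eb'
    by (auto simp: A.atom_le_comp_left A.meet_closed A.comp_closed A.conv_closed)
  note ed = e_atom[OF d(1)] and ed' = A.atom_closed[OF e_atom[OF d(1)]]
  have ds: "ra_le A (e d) s" and "ra_le A (e d) (conv\<^bsub>A\<^esub> r ;;\<^bsub>A\<^esub> e b)"
    using d assms eb' ed' by (simp_all add: A.le_meet_iff A.comp_closed A.conv_closed)
  then have "ra_le A (e b) (r ;;\<^bsub>A\<^esub> e d)"
    using A.atom_cycle_left eb ed assms by blast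
  \<comment> \<open>The same on the other side, with \<open>s\<close> already replaced by
    \<open>e d\<close>.\<close>
  then obtain c where c: "ra_atom B c" "ra_le A (e c) (ra_meet A (e b ;;\<^bsub>A\<^esub> conv\<^bsub>A\<^esub> (e d)) r)"
    using atom_below[of "ra_meet A (e b ;;\<^bsub>A\<^esub> conv\<^bsub>A\<^esub> (e d)) r"] assms eb eb' ed'
    by (auto simp: A.atom_le_comp_right A.meet_closed A.comp_closed A.conv_closed)
  note ec = e_atom[OF c(1)] and ec' = A.atom_closed[OF e_atom[OF c(1)]]
  have cr: "ra_le A (e c) r" and "ra_le A (e c) (e b ;;\<^bsub>A\<^esub> conv\<^bsub>A\<^esub> (e d))"
    using c assms eb' ed' ec' by (simp_all add: A.le_meet_iff A.comp_closed A.conv_closed)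
  then have "ra_le A (e b) (e c ;;\<^bsub>A\<^esub> e d)"
    using A.atom_cycle_right[OF eb ec ed'] by blast
  then have "ra_le B b (c ;;\<^bsub>B\<^esub> d)"
    using assms c d by (metis e_comp e_le_iff B.comp_closed B.atom_closed)
  then show "\<exists>c\<in>atoms_below r. \<exists>d\<in>atoms_below s. ra_le B b (c ;;\<^bsub>B\<^esub> d)"
    using c d cr ds by (auto simp: atoms_below_def)
next
  assume "\<exists>c\<in>atoms_below r. \<exists>d\<in>atoms_below s. ra_le B b (c ;;\<^bsub>B\<^esub> d)"
  then obtain c d where cd: "ra_atom B c" "ra_le A (e c) r" "ra_atom B d" "ra_le A (e d) s"
      "ra_le B b (c ;;\<^bsub>B\<^esub> d)"
    by (auto simp: atoms_below_def)
  then have "ra_le A (e b) (e c ;;\<^bsub>A\<^esub> e d)"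
    using assms by (metis e_comp e_le_iff B.comp_closed B.atom_closed)
  moreover have "ra_le A (e c ;;\<^bsub>A\<^esub> e d) (r ;;\<^bsub>A\<^esub> s)"
    using cd assms by (simp add: A.comp_mono e_closed B.atom_closed)
  ultimately show "ra_le A (e b) (r ;;\<^bsub>A\<^esub> s)"
    using cd assms by (metis A.le_trans A.comp_closed e_closed B.atom_closed)
qed

lemma atoms_below_conv:
  assumes "a \<in> carrier A"
  shows "atoms_below (conv\<^bsub>A\<^esub> a) = ra_conv B ` atoms_below a"
proof -
  have *: "conv\<^bsub>B\<^esub> b \<in> atoms_below (conv\<^bsub>A\<^esub> c)"
    if "b \<in> atoms_below c" "c \<in> carrier A" for b c
    using that by (simp add: atoms_below_def B.atom_conv e_conv B.atom_closed A.conv_mono e_closed)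
  have "b \<in> ra_conv B ` atoms_below a" if "b \<in> atoms_below (conv\<^bsub>A\<^esub> a)" for b
    using *[OF that] assms that
    by (intro image_eqI[of _ _ "conv\<^bsub>B\<^esub> b"])
      (auto simp: A.conv_conv A.conv_closed B.conv_conv atoms_below_def B.atom_closed)
  then show ?thesis
    using * assms by blast
qed

lemma atoms_below_hom: "atoms_below \<in> ra_hom A (atom_algebra B)"
  unfolding ra_hom_def atom_algebra_def
proof (simp, intro conjI ballI)
  show "atoms_below \<in> carrier A \<rightarrow> Pow {x. ra_atom B x}"
    by (auto simp: atoms_below_def)
next
  fix a c assume "a \<in> carrier A" "c \<in> carrier A"
  then show "atoms_below (a \<uplus>\<^bsub>A\<^esub> c) = atoms_below a \<union> atoms_below c"
    by (auto simp: atoms_below_def A.atom_le_join_iff e_atom)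
next
  fix a assume "a \<in> carrier A"
  then show "atoms_below (\<sim>\<^bsub>A\<^esub> a) = {x. ra_atom B x} - atoms_below a"
    by (auto simp: atoms_below_def A.atom_le_compl_iff e_atom)
next
  fix a c assume "a \<in> carrier A" "c \<in> carrier A"
  then show "atoms_below (a ;;\<^bsub>A\<^esub> c) = {z. \<exists>x\<in>atoms_below a. ra_atom B x \<and>
      (\<exists>y\<in>atoms_below c. ra_atom B y \<and> ra_atom B z \<and> ra_le B z (x ;;\<^bsub>B\<^esub> y))}"
    unfolding atoms_below_def[of "a ;;\<^bsub>A\<^esub> c"]
    by (simp add: e_le_comp_iff cong: conj_cong) (auto simp: atoms_below_def)
next
  fix a assume "a \<in> carrier A"
  then show "atoms_below (conv\<^bsub>A\<^esub> a) = ra_conv B ` atoms_below a"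
    by (rule atoms_below_conv)
next
  show "atoms_below \<iota>\<^bsub>A\<^esub> = {x. ra_atom B x \<and> ra_le B x \<iota>\<^bsub>B\<^esub>}"
    by (auto simp: atoms_below_def e_le_iff B.atom_closed B.id_closed simp flip: e_id)
qed

lemma atoms_below_inj: "inj_on atoms_below (carrier A)"
  by (intro inj_onI A.le_antisym le_if_atoms_below) auto

text \<open>The preimage of \<open>X\<close> is the supremum of the images of its members; complete
  primeness of atoms keeps further atoms from lying below it.\<close>

lemma atoms_below_surj:
  assumes "ra_complete A" "X \<subseteq> {x. ra_atom B x}"
  shows "X \<in> atoms_below ` carrier A"
proof -
  interpret L: complete_lattice "ra_order A"
    using assms by (simp add: ra_complete_def)
  have eX: "e ` X \<subseteq> carrier A"
    using assms by (auto simp: B.atom_closed e_closed)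
  then obtain s where s: "least (ra_order A) s (Upper (ra_order A) (e ` X))"
    using L.sup_exists[of "e ` X"] unfolding ra_order_def by auto
  then have sup: "ra_is_sup A (e ` X) s"
    using eX by (simp add: ra_is_sup_def)
  have "s \<in> carrier A" and up: "\<And>x. x \<in> X \<Longrightarrow> ra_le A (e x) s"
    using s eX by (auto simp: least_def Upper_def ra_order_def)
  moreover have "b \<in> X" if b: "ra_atom B b" "ra_le A (e b) s" for b
  proof -
    obtain x where x: "x \<in> X" "ra_le A (e b) (e x)"
      using A.atom_le_sup[OF e_atom[OF b(1)] sup] b(2) by auto
    then have "b = x"
      using b assms(2) e_le_iff B.atom_closed B.atoms_eq by (metis mem_Collect_eq subsetD)
    then show ?thesis using x by simp
  qed
  ultimately have "atoms_below s = X"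
    using assms by (auto simp: atoms_below_def)
  then show ?thesis using \<open>s \<in> carrier A\<close> by blast
qed

lemma atoms_below_iso:
  assumes "ra_complete A"
  shows "ra_isomorphic A (atom_algebra B)"
proof -
  have "bij_betw atoms_below (carrier A) (carrier (atom_algebra B))"
    using atoms_below_inj atoms_below_surj[OF assms]
    by (auto simp: bij_betw_def atom_algebra_def atoms_below_def)
  then show ?thesis
    using atoms_below_hom by (auto simp: ra_isomorphic_def)
qed

end

section \<open>The atom algebra as the completion\<close>

lemma dense_embedding_self:
  "\<lbrakk>relation_algebra B; ra_atomic B\<rbrakk> \<Longrightarrow> dense_embedding B B id"
  by (auto simp: dense_embedding_def dense_embedding_axioms_def ra_hom_def
      intro: boolean_part.le_refl relation_algebra.axioms(1))

lemma atom_structure_of_relation_algebra: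
  assumes "relation_algebra B" "ra_atomic B"
  shows "atom_structure {x. ra_atom B x}
     (\<lambda>a b c. ra_atom B a \<and> ra_atom B b \<and> ra_atom B c \<and> ra_le B c (a ;;\<^bsub>B\<^esub> b))
     (ra_conv B) {x. ra_atom B x \<and> ra_le B x \<iota>\<^bsub>B\<^esub>}"
proof -
  interpret B: dense_embedding B B id
    using assms by (rule dense_embedding_self)
  \<comment> \<open>This is \<open>e_le_comp_iff\<close> for the identity embedding.\<close>
  have comp: "ra_le B x (r ;;\<^bsub>B\<^esub> s) \<longleftrightarrow> (\<exists>c d. ra_atom B c \<and> ra_atom B d \<and>
      ra_le B c r \<and> ra_le B d s \<and> ra_le B x (c ;;\<^bsub>B\<^esub> d))"
    if "ra_atom B x" "r \<in> carrier B" "s \<in> carrier B" for x r s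
    using B.e_le_comp_iff[OF that] by (auto simp: B.atoms_below_def)
  note closed = B.A.atom_closed B.A.comp_closed B.A.conv_closed B.A.id_closed
  show ?thesis
  proof (unfold_locales, goal_cases)
    case (5 a b c)
    then show ?case by (simp add: B.A.atom_conv closed flip: B.A.atom_cycle_left)
  next
    case (6 a b c)
    then show ?case
      by (simp add: B.A.atom_conv closed B.A.conv_mono flip: B.A.conv_comp)
  next
    case (7 a b u c d)
    then have "ra_le B d ((a ;;\<^bsub>B\<^esub> b) ;;\<^bsub>B\<^esub> c)"
      by (meson B.A.comp_mono B.A.le_refl B.A.le_trans closed)
    then have "ra_le B d (a ;;\<^bsub>B\<^esub> (b ;;\<^bsub>B\<^esub> c))"
      using 7 by (simp add: B.A.comp_assoc closed)
    \<comment> \<open>Splitting the product into atoms: \<open>p\<close>, being below the atom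
      \<open>a\<close>, is \<open>a\<close>, and \<open>q\<close> is the intermediate atom
      sought.\<close>
    then obtain p q where pq: "ra_atom B p" "ra_atom B q" "ra_le B p a"
        "ra_le B q (b ;;\<^bsub>B\<^esub> c)" "ra_le B d (p ;;\<^bsub>B\<^esub> q)"
      using comp[of d a "b ;;\<^bsub>B\<^esub> c"] 7 closed by auto
    then have "p = a" using 7 B.A.atoms_eq by blast
    then show ?case using pq 7 by blast
  next
    case (8 a)
    then have "ra_le B a (a ;;\<^bsub>B\<^esub> \<iota>\<^bsub>B\<^esub>)"
      by (simp add: B.A.comp_id B.A.le_refl closed)
    then show ?case
      using comp[of a a "\<iota>\<^bsub>B\<^esub>"] 8 closed B.A.atoms_eq by (metis mem_Collect_eq)
  next
    case (9 a i b)
    then have "ra_le B b (a ;;\<^bsub>B\<^esub> \<iota>\<^bsub>B\<^esub>)"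
      by (metis (mono_tags, lifting) mem_Collect_eq B.A.comp_mono B.A.le_refl B.A.le_trans closed)
    then show ?case
      using 9 B.A.atoms_eq by (auto simp: B.A.comp_id closed)
  qed (auto simp: B.A.atom_conv B.A.conv_conv closed)
qed

lemma relation_algebra_atom_algebra:
  "\<lbrakk>relation_algebra B; ra_atomic B\<rbrakk> \<Longrightarrow> relation_algebra (atom_algebra B)"
  unfolding atom_algebra_def
  by (intro atom_structure.relation_algebra_complex_algebra atom_structure_of_relation_algebra)

text \<open>The embedding is \<open>B.atoms_below\<close>. It is dense because a nonempty set
  contains an atom \<open>x\<close>, and only \<open>x\<close> lies below \<open>x\<close>.\<close>

lemma atom_algebra_completion:
  assumes "relation_algebra B" "ra_atomic B"
  shows "is_completion (atom_algebra B) B"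
proof -
  interpret B: dense_embedding B B id
    using assms by (rule dense_embedding_self)
  have "\<exists>b\<in>carrier B. b \<noteq> ra_zero B \<and> ra_le (atom_algebra B) (B.atoms_below b) X"
    if X: "X \<in> carrier (atom_algebra B)" "X \<noteq> ra_zero (atom_algebra B)" for X
  proof -
    obtain x where x: "x \<in> X" "ra_atom B x"
      using X by (auto simp: atom_algebra_def)
    have "B.atoms_below x \<subseteq> {x}"
      using x B.A.atoms_eq by (auto simp: B.atoms_below_def)
    then show ?thesis
      using x by (auto simp: atom_algebra_def ra_atom_def intro!: bexI[of _ x])
  qed
  moreover have "ra_complete (atom_algebra B)"
    by (simp add: atom_algebra_def ra_complete_complex_algebra)
  ultimately show ?thesis
    unfolding is_completion_def
    using B.atoms_below_hom B.atoms_below_inj relation_algebra_atom_algebra[OF assms] by blast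
qed

lemma completion_iso_atom_algebra:
  assumes "relation_algebra B" "ra_atomic B" "is_completion A B"
  shows "ra_isomorphic A (atom_algebra B)"
proof -
  obtain e where "dense_embedding A B e"
    using assms by (auto simp: is_completion_def dense_embedding_def dense_embedding_axioms_def)
  then show ?thesis
    using assms by (auto simp: is_completion_def intro: dense_embedding.atoms_below_iso)
qed

section \<open>Groups of atoms and their actions\<close>

text \<open>\<open>functional\<close> is the trace of measurability on atoms: an atom running from a
  subidentity atom to itself is a function.\<close>

locale measured_atom_structure = atom_structure +
  assumes functional: "\<lbrakk>i \<in> J; T i a a; T a i a; T (cv a) a c\<rbrakk> \<Longrightarrow> c \<in> J"
begin

section \<open>Endpoints of atoms and composability\<close>

definition arrows :: "'a \<Rightarrow> 'a \<Rightarrow> 'a set" where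
  "arrows x y = {a. x \<in> J \<and> y \<in> J \<and> T x a a \<and> T a y a}"

text \<open>Meaningful when one factor is a loop, since then the product is a single atom. It serves
  as group multiplication and as left and right action alike.\<close>

definition act :: "'a \<Rightarrow> 'a \<Rightarrow> 'a" (infixl \<open>\<odot>\<close> 70) where
  "a \<odot> b = (THE c. T a b c)"

lemma arrows_J: "a \<in> arrows x y \<Longrightarrow> x \<in> J" "a \<in> arrows x y \<Longrightarrow> y \<in> J"
  by (auto simp: arrows_def)

lemma arrows_At: "a \<in> arrows x y \<Longrightarrow> a \<in> At"
  using T_closed by (auto simp: arrows_def)

lemma ex_arrows: "a \<in> At \<Longrightarrow> \<exists>x y. a \<in> arrows x y"
  using T_left_id_ex T_right_id_ex unfolding arrows_def by blast

text \<open>By associativity two left identities of \<open>a\<close> have a nonempty product, and an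
  atom of that product equals both of them.\<close>

lemma source_unique:
  assumes "x \<in> J" "x' \<in> J" "T x a a" "T x' a a"
  shows "x = x'"
proof -
  obtain u where "T x x' u"
    using T_assoc'[OF assms(4,3)] by blast
  then show ?thesis
    using T_left_id T_right_id assms by metis
qed

lemma cv_arrows: "a \<in> arrows x y \<Longrightarrow> cv a \<in> arrows y x"
  unfolding arrows_def by (metis (mono_tags, lifting) T_cv cv_J mem_Collect_eq)

lemma arrows_unique:
  assumes "a \<in> arrows x y" "a \<in> arrows x' y'"
  shows "x = x' \<and> y = y'"
  using assms cv_arrows[OF assms(1)] cv_arrows[OF assms(2)] source_unique
  unfolding arrows_def by blast

lemma T_arrows:
  assumes "T a b c" "a \<in> arrows x y" "b \<in> arrows y' z"
  shows "y' = y" and "c \<in> arrows x z"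
proof -
  have "T x c c"
    using T_assoc[of x a a b c] T_left_id assms by (auto simp: arrows_def)
  moreover have "T c z c"
    using T_assoc'[of b z b a c] T_right_id assms by (auto simp: arrows_def)
  ultimately show "c \<in> arrows x z"
    using assms by (auto simp: arrows_def)
  have "T y b b"
    using T_assoc[of a y a b c] T_left_id assms by (auto simp: arrows_def)
  then show "y' = y"
    using assms source_unique by (auto simp: arrows_def)
qed

text \<open>The vertex \<open>y\<close> lies below \<open>b ; cv b\<close>, so associativity applied
  to \<open>T a y a\<close> passes through an atom of \<open>a ; b\<close>.\<close>

lemma T_ex:
  assumes "a \<in> arrows x y" "b \<in> arrows y z"
  shows "\<exists>c. T a b c"
  using assms T_cycle'[of y b b] T_assoc'[of b "cv b" y a a] by (auto simp: arrows_def)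

text \<open>Going back along \<open>g\<close> from \<open>c\<close> and forward to \<open>c'\<close>
  gives an atom \<open>u\<close> of \<open>g ; cv g\<close> with \<open>T u c c'\<close>. As the
  loop \<open>cv g\<close> is a function, \<open>u\<close> is an identity atom.\<close>

lemma loop_unique_left:
  assumes "g \<in> arrows x x" "T g b c" "T g b c'"
  shows "c = c'"
proof -
  obtain u where u: "T g (cv g) u" "T u c c'"
    using T_assoc'[OF T_cycle[OF assms(2)] assms(3)] by blast
  have "u \<in> J"
    using functional[of x "cv g" u] u cv_arrows[OF assms(1)] cv_cv[OF arrows_At[OF assms(1)]]
    by (auto simp: arrows_def)
  then show ?thesis
    using u T_left_id by blast
qed

lemma loop_unique_right:
  assumes "k \<in> arrows y y" "T a k c" "T a k c'"
  shows "c = c'"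
  using loop_unique_left[OF cv_arrows[OF assms(1)] T_cv[OF assms(2)] T_cv[OF assms(3)]]
  using assms T_closed cv_cv by metis

section \<open>The left and right actions of loops\<close>

lemma T_loop_left:
  assumes "g \<in> arrows x x" "a \<in> arrows x y"
  shows "T g a c \<longleftrightarrow> c = g \<odot> a"
proof -
  obtain d where "T g a d" using T_ex assms by blast
  moreover have "g \<odot> a = d"
    unfolding act_def
    using calculation assms(1) loop_unique_left by (intro the_equality) blast+
  ultimately show ?thesis
    using assms(1) loop_unique_left by blast
qed

lemma T_loop_right:
  assumes "a \<in> arrows x y" "k \<in> arrows y y"
  shows "T a k c \<longleftrightarrow> c = a \<odot> k"
proof -
  obtain d where "T a k d" using T_ex assms by blast
  moreover have "a \<odot> k = d"
    unfolding act_def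
    using calculation assms(2) loop_unique_right by (intro the_equality) blast+
  ultimately show ?thesis
    using assms(2) loop_unique_right by blast
qed

lemma act_left: "\<lbrakk>g \<in> arrows x x; a \<in> arrows x y\<rbrakk> \<Longrightarrow> g \<odot> a \<in> arrows x y"
  using T_arrows(2) T_loop_left by blast

lemma act_right: "\<lbrakk>a \<in> arrows x y; k \<in> arrows y y\<rbrakk> \<Longrightarrow> a \<odot> k \<in> arrows x y"
  using T_arrows(2) T_loop_right by blast

text \<open>Where a loop is a factor, products are single-valued, so associativity of
  \<open>T\<close> becomes an equation; the next two lemmas follow the same pattern.\<close>

lemma act_left_assoc:
  assumes "g \<in> arrows x x" "h \<in> arrows x x" "a \<in> arrows x y"
  shows "(g \<odot> h) \<odot> a = g \<odot> (h \<odot> a)"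
proof -
  have "T h a (h \<odot> a)" "T g (h \<odot> a) (g \<odot> (h \<odot> a))"
    using assms T_loop_left act_left by blast+
  then obtain u where "T g h u" "T u a (g \<odot> (h \<odot> a))"
    using T_assoc' by blast
  then show ?thesis
    using assms T_loop_left act_left by metis
qed

lemma act_middle_assoc:
  assumes "g \<in> arrows x x" "a \<in> arrows x y" "k \<in> arrows y y"
  shows "(g \<odot> a) \<odot> k = g \<odot> (a \<odot> k)"
proof -
  have "T a k (a \<odot> k)" "T g (a \<odot> k) (g \<odot> (a \<odot> k))"
    using assms T_loop_left T_loop_right act_right by blast+
  then obtain u where "T g a u" "T u k (g \<odot> (a \<odot> k))"
    using T_assoc' by blast
  then show ?thesis
    using assms T_loop_left T_loop_right act_left by metis
qed

lemma act_right_assoc: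
  assumes "a \<in> arrows x y" "k \<in> arrows y y" "l \<in> arrows y y"
  shows "(a \<odot> k) \<odot> l = a \<odot> (k \<odot> l)"
proof -
  have "T k l (k \<odot> l)" "T a (k \<odot> l) (a \<odot> (k \<odot> l))"
    using assms T_loop_right act_right by blast+
  then obtain u where "T a k u" "T u l (a \<odot> (k \<odot> l))"
    using T_assoc' by blast
  then show ?thesis
    using assms T_loop_right act_right by metis
qed

lemma J_arrows: "x \<in> J \<Longrightarrow> x \<in> arrows x x"
  using T_left_id_ex[of x] T_right_id[of _ x] J_closed[of x] by (auto simp: arrows_def)

lemma act_left_id: "a \<in> arrows x y \<Longrightarrow> x \<odot> a = a"
  using T_loop_left[of x x a y a] J_arrows by (auto simp: arrows_def)

lemma act_right_id: "a \<in> arrows x y \<Longrightarrow> a \<odot> y = a"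
  using T_loop_right[of a x y y a] J_arrows by (auto simp: arrows_def)

lemma cv_act_left: "\<lbrakk>g \<in> arrows x x; a \<in> arrows x y\<rbrakk> \<Longrightarrow> cv (g \<odot> a) = cv a \<odot> cv g"
  using T_cv[of g a "g \<odot> a"] T_loop_left[of g x a y] T_loop_right[of "cv a" y x "cv g"]
  by (simp add: cv_arrows)

lemma cv_act_right: "\<lbrakk>a \<in> arrows x y; k \<in> arrows y y\<rbrakk> \<Longrightarrow> cv (a \<odot> k) = cv k \<odot> cv a"
  using T_cv[of a k "a \<odot> k"] T_loop_right[of a x y k] T_loop_left[of "cv k" y "cv a" x]
  by (simp add: cv_arrows)

lemma cv_act_self: "g \<in> arrows x x \<Longrightarrow> cv g \<odot> g = x"
  using T_cycle[of g x g] T_loop_left[of "cv g" x g x x] cv_arrows by (auto simp: arrows_def)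

lemma act_cv_self: "g \<in> arrows x x \<Longrightarrow> g \<odot> cv g = x"
  using cv_act_self[of "cv g" x] cv_arrows cv_cv arrows_At by metis

lemma act_left_cancel:
  assumes "g \<in> arrows x x" "a \<in> arrows x y"
  shows "cv g \<odot> (g \<odot> a) = a" "g \<odot> (cv g \<odot> a) = a"
  using assms act_left_assoc[of "cv g" x g a y] act_left_assoc[of g x "cv g" a y]
  by (simp_all add: cv_arrows cv_act_self act_cv_self act_left_id)

lemma act_right_cancel:
  assumes "a \<in> arrows x y" "k \<in> arrows y y"
  shows "(a \<odot> k) \<odot> cv k = a" "(a \<odot> cv k) \<odot> k = a"
  using assms act_right_assoc[of a x y k "cv k"] act_right_assoc[of a x y "cv k" k]
  by (simp_all add: cv_arrows cv_act_self act_cv_self act_right_id)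

section \<open>Transitivity, stabilizers and orbits\<close>

lemma transitive_left:
  assumes "a \<in> arrows x y" "b \<in> arrows x y"
  shows "\<exists>g\<in>arrows x x. b = g \<odot> a"
proof -
  \<comment> \<open>Division of \<open>b\<close> by \<open>a\<close>: any atom of
    \<open>b ; cv a\<close> will do.\<close>
  obtain g where g: "T b (cv a) g"
    using T_ex assms cv_arrows by blast
  then have "T g a b"
    using T_cycle' cv_cv arrows_At assms by metis
  moreover have "g \<in> arrows x x"
    using g T_arrows(2) assms cv_arrows by blast
  ultimately show ?thesis
    using T_loop_left assms by blast
qed

lemma transitive_right:
  assumes "a \<in> arrows x y" "b \<in> arrows x y"
  shows "\<exists>k\<in>arrows y y. b = a \<odot> k"
proof -
  obtain k where k: "T (cv a) b k"
    using T_ex assms cv_arrows by blast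
  then have "T a k b"
    using T_cycle cv_cv arrows_At assms by metis
  moreover have "k \<in> arrows y y"
    using k T_arrows(2) assms cv_arrows by blast
  ultimately show ?thesis
    using T_loop_right assms by blast
qed

text \<open>Write \<open>b = a \<odot> k\<close>; the two actions commute. Hence stabilizers do not
  depend on the chosen point, which is what makes them normal.\<close>

lemma stabilizer_left:
  assumes "h \<in> arrows x x" "a \<in> arrows x y" "b \<in> arrows x y" "h \<odot> a = a"
  shows "h \<odot> b = b"
  using assms transitive_right[of a x y b] act_middle_assoc by metis

lemma stabilizer_right:
  assumes "a \<in> arrows x y" "b \<in> arrows x y" "k \<in> arrows y y" "a \<odot> k = a"
  shows "b \<odot> k = b"
  using assms transitive_left[of a x y b] act_middle_assoc by metis

lemma T_act_left:
  assumes "T a b c" "g \<in> arrows x x" "a \<in> arrows x y" "b \<in> arrows y z"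
  shows "T (g \<odot> a) b (g \<odot> c)"
proof -
  have "T g c (g \<odot> c)"
    using assms T_arrows(2) T_loop_left by blast
  then obtain u where "T g a u" "T u b (g \<odot> c)"
    using T_assoc' assms by blast
  then show ?thesis
    using assms T_loop_left by metis
qed

lemma T_act_right:
  assumes "T a b c" "a \<in> arrows x y" "b \<in> arrows y z" "m \<in> arrows z z"
  shows "T a (b \<odot> m) (c \<odot> m)"
proof -
  have "T c m (c \<odot> m)"
    using assms T_arrows(2) T_loop_right by blast
  then obtain u where "T b m u" "T a u (c \<odot> m)"
    using T_assoc assms by blast
  then show ?thesis
    using assms T_loop_right by metis
qed

text \<open>Elements of the middle group pass from one factor to the other, as in a tensor
  product.\<close>

lemma T_act_middle:
  assumes "a \<in> arrows x y" "k \<in> arrows y y" "b \<in> arrows y z"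
  shows "T (a \<odot> k) b c \<longleftrightarrow> T a (k \<odot> b) c"
proof
  assume "T (a \<odot> k) b c"
  moreover have "T a k (a \<odot> k)"
    using assms T_loop_right by blast
  ultimately obtain u where "T k b u" "T a u c"
    using T_assoc by blast
  then show "T a (k \<odot> b) c"
    using assms T_loop_left by metis
next
  assume "T a (k \<odot> b) c"
  moreover have "T k b (k \<odot> b)"
    using assms T_loop_left by blast
  ultimately obtain u where "T a k u" "T u b c"
    using T_assoc' by blast
  then show "T (a \<odot> k) b c"
    using assms T_loop_right by metis
qed

text \<open>The atoms below \<open>a ; b\<close> form one orbit of the stabilizer of
  \<open>a\<close>: \<open>c'\<close> is reached from \<open>c\<close> by an atom \<open>h\<close>
  of \<open>a ; cv a\<close>, and cycling shows that such an \<open>h\<close> fixes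
  \<open>a\<close>.\<close>

lemma T_orbit_left:
  assumes "T a b c" "T a b c'" "a \<in> arrows x y" "b \<in> arrows y z"
  shows "\<exists>h\<in>arrows x x. h \<odot> a = a \<and> c' = h \<odot> c"
proof -
  obtain h where h: "T a (cv a) h" "T h c c'"
    using T_assoc'[OF T_cycle[OF assms(1)] assms(2)] by blast
  then have "h \<in> arrows x x"
    using assms T_arrows(2) cv_arrows by blast
  moreover have "T h a a"
    using T_cycle'[OF h(1)] cv_cv arrows_At assms by metis
  ultimately show ?thesis
    using h assms T_loop_left T_arrows(2) by metis
qed

text \<open>The same argument with an atom \<open>k\<close> of \<open>cv a ; a\<close>, which fixes
  \<open>a\<close> from the right.\<close>

lemma T_orbit_middle:
  assumes "T a b c" "T a b' c" "a \<in> arrows x y" "b \<in> arrows y z"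
  shows "\<exists>k\<in>arrows y y. a \<odot> k = a \<and> b' = k \<odot> b"
proof -
  obtain k where k: "T (cv a) a k" "T k b b'"
    using T_assoc'[OF assms(1) T_cycle[OF assms(2)]] by blast
  then have "k \<in> arrows y y"
    using assms T_arrows(2) cv_arrows by blast
  moreover have "T a k a"
    using T_cycle[OF k(1)] cv_cv arrows_At assms by metis
  ultimately show ?thesis
    using k assms T_loop_left T_loop_right by metis
qed

section \<open>Vertex groups and base atoms\<close>

definition vertex_group :: "'a \<Rightarrow> 'a monoid" where
  "vertex_group x = \<lparr>carrier = arrows x x, mult = (\<odot>), one = x\<rparr>"

lemma vertex_group_simps [simp]:
  "carrier (vertex_group x) = arrows x x"
  "mult (vertex_group x) = (\<odot>)"
  "one (vertex_group x) = x"
  by (simp_all add: vertex_group_def)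

lemma group_vertex_group: "x \<in> J \<Longrightarrow> group (vertex_group x)"
  by (rule groupI)
    (auto simp: act_left act_left_assoc act_left_id J_arrows intro: cv_arrows cv_act_self)

lemma inv_vertex_group: "g \<in> arrows x x \<Longrightarrow> inv\<^bsub>vertex_group x\<^esub> g = cv g"
  by (rule group.inv_equality) (auto simp: group_vertex_group arrows_J cv_arrows cv_act_self)

text \<open>
  The choice is made in the union of both directions, so that it is the same for \<open>(x, y)\<close> and
  \<open>(y, x)\<close> and hence compatible with converse.
\<close>

definition base :: "'a \<Rightarrow> 'a \<Rightarrow> 'a" where
  "base x y = (if x = y then x else
     let a = SOME a. a \<in> arrows x y \<union> arrows y x in if a \<in> arrows x y then a else cv a)"

definition connected :: "('a \<times> 'a) set" where
  "connected = {(x, y). arrows x y \<noteq> {}}"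

lemma connected_J: "(x, y) \<in> connected \<Longrightarrow> x \<in> J" "(x, y) \<in> connected \<Longrightarrow> y \<in> J"
  using arrows_J by (auto simp: connected_def)

lemma connected_sym: "(x, y) \<in> connected \<Longrightarrow> (y, x) \<in> connected"
  using cv_arrows by (auto simp: connected_def)

lemma connected_trans: "\<lbrakk>(x, y) \<in> connected; (y, z) \<in> connected\<rbrakk> \<Longrightarrow> (x, z) \<in> connected"
  using T_ex T_arrows(2) by (fastforce simp: connected_def)

lemma connected_refl: "x \<in> J \<Longrightarrow> (x, x) \<in> connected"
  using J_arrows by (auto simp: connected_def)

lemma equiv_connected: "equiv J connected"
  by (rule equivI)
    (auto simp: connected_J intro!: refl_onI symI transI intro: connected_refl connected_sym connected_trans)

lemma base_refl: "base x x = x"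
  by (simp add: base_def)

lemma base_arrows:
  assumes "(x, y) \<in> connected"
  shows "base x y \<in> arrows x y"
proof -
  have "(SOME a. a \<in> arrows x y \<union> arrows y x) \<in> arrows x y \<union> arrows y x"
    using assms by (simp only: some_in_eq) (auto simp: connected_def)
  then show ?thesis
    using assms cv_arrows J_arrows connected_J by (auto simp: base_def Let_def)
qed

lemma base_sym:
  assumes "(x, y) \<in> connected"
  shows "base y x = cv (base x y)"
proof (cases "x = y")
  case True
  then show ?thesis using assms by (simp add: base_refl cv_J connected_J)
next
  case False
  define a where "a = (SOME a. a \<in> arrows x y \<union> arrows y x)"
  have "a \<in> arrows x y \<union> arrows y x"
    unfolding a_def using assms by (simp only: some_in_eq) (auto simp: connected_def)
  moreover have "base x y = (if a \<in> arrows x y then a else cv a)"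
    using False by (simp add: base_def a_def)
  moreover have "base y x = (if a \<in> arrows y x then a else cv a)"
    using False by (simp add: base_def a_def Un_commute)
  \<comment> \<open>Since \<open>x \<noteq> y\<close>, the common choice \<open>a\<close> lies in
    exactly one of the two sets of arrows.\<close>
  ultimately show ?thesis
    using False arrows_unique cv_cv arrows_At by auto
qed

section \<open>The group triple of a measured atom structure\<close>

text \<open>Transitivity of the commuting right action carries an equation between left translates
  from one arrow to every parallel one.\<close>

lemma left_eq_transfer:
  assumes "g \<odot> a = g' \<odot> a" "g \<in> arrows x x" "g' \<in> arrows x x" "a \<in> arrows x y" "b \<in> arrows x y"
  shows "g \<odot> b = g' \<odot> b"
proof -
  obtain k where "k \<in> arrows y y" "b = a \<odot> k"
    using transitive_right assms by blast
  then show ?thesis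
    using assms by (simp flip: act_middle_assoc)
qed

lemma right_eq_transfer:
  assumes "a \<odot> k = a \<odot> k'" "k \<in> arrows y y" "k' \<in> arrows y y" "a \<in> arrows x y" "b \<in> arrows x y"
  shows "b \<odot> k = b \<odot> k'"
proof -
  obtain g where "g \<in> arrows x x" "b = g \<odot> a"
    using transitive_left assms by blast
  then show ?thesis
    using assms by (simp add: act_middle_assoc)
qed

definition stabL :: "'a \<Rightarrow> 'a \<Rightarrow> 'a set" where
  "stabL x y = {h \<in> arrows x x. h \<odot> base x y = base x y}"

definition stabR :: "'a \<Rightarrow> 'a \<Rightarrow> 'a set" where
  "stabR x y = {k \<in> arrows y y. base x y \<odot> k = base x y}"

text \<open>Cosets of the stabilizers are labelled by arrows: \<open>cosL x y b\<close> and
  \<open>cosR x y b\<close> are the fibres over \<open>b\<close> of the two orbit maps of the base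
  atom. In these labels \<open>phi x y\<close> is the identity (\<open>phi_cosL\<close>).\<close>

definition cosL :: "'a \<Rightarrow> 'a \<Rightarrow> 'a \<Rightarrow> 'a set" where
  "cosL x y b = {g \<in> arrows x x. g \<odot> base x y = b}"

definition cosR :: "'a \<Rightarrow> 'a \<Rightarrow> 'a \<Rightarrow> 'a set" where
  "cosR x y b = {k \<in> arrows y y. base x y \<odot> k = b}"

definition phi :: "'a \<Rightarrow> 'a \<Rightarrow> 'a set \<Rightarrow> 'a set" where
  "phi x y \<xi> = {k \<in> arrows y y. \<exists>g\<in>\<xi>. g \<odot> base x y = base x y \<odot> k}"

definition offset :: "'a \<Rightarrow> 'a \<Rightarrow> 'a \<Rightarrow> 'a set" where
  "offset x y z = {g \<in> arrows x x. T (base x y) (base y z) (g \<odot> base x z)}"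

definition frame :: "('a, 'a) group_triple" where
  "frame = \<lparr>gt_index = J, gt_eqv = connected, gt_group = vertex_group, gt_H = stabL,
     gt_K = stabR, gt_phi = phi, gt_C = offset\<rparr>"

lemma frame_simps [simp]:
  "gt_index frame = J" "gt_eqv frame = connected" "gt_group frame = vertex_group"
  "gt_H frame = stabL" "gt_K frame = stabR" "gt_phi frame = phi" "gt_C frame = offset"
  by (simp_all add: frame_def)

section \<open>Stabilizers of the base atoms and their cosets\<close>

lemma stabL_fixes: "\<lbrakk>h \<in> stabL x y; b \<in> arrows x y; (x, y) \<in> connected\<rbrakk> \<Longrightarrow> h \<odot> b = b"
  using stabilizer_left[of h x "base x y" y b] base_arrows by (auto simp: stabL_def)

lemma stabR_fixes: "\<lbrakk>k \<in> stabR x y; b \<in> arrows x y; (x, y) \<in> connected\<rbrakk> \<Longrightarrow> b \<odot> k = b"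
  using stabilizer_right[of "base x y" x y b k] base_arrows by (auto simp: stabR_def)

lemma stabL_I: "\<lbrakk>h \<odot> b = b; h \<in> arrows x x; b \<in> arrows x y; (x, y) \<in> connected\<rbrakk> \<Longrightarrow> h \<in> stabL x y"
  using stabilizer_left[of h x b y "base x y"] base_arrows by (auto simp: stabL_def)

lemma stabR_I: "\<lbrakk>b \<odot> k = b; k \<in> arrows y y; b \<in> arrows x y; (x, y) \<in> connected\<rbrakk> \<Longrightarrow> k \<in> stabR x y"
  using stabilizer_right[of b x y "base x y" k] base_arrows by (auto simp: stabR_def)

lemma stabL_arrows: "h \<in> stabL x y \<Longrightarrow> h \<in> arrows x x"
  and stabR_arrows: "k \<in> stabR x y \<Longrightarrow> k \<in> arrows y y"
  by (auto simp: stabL_def stabR_def)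

lemma normal_stabL:
  assumes xy: "(x, y) \<in> connected"
  shows "stabL x y \<lhd> vertex_group x"
proof (rule group.normal_invI)
  show "group (vertex_group x)"
    using group_vertex_group connected_J xy by blast
  have b: "base x y \<in> arrows x y" using base_arrows xy .
  show "subgroup (stabL x y) (vertex_group x)"
  proof (rule subgroup.intro, goal_cases)
    case 1 show ?case by (auto simp: stabL_def)
  next
    case (2 g h)
    then show ?case using b act_left_assoc[of g x h "base x y" y] by (simp add: stabL_def act_left)
  next
    case 3
    show ?case using b by (simp add: stabL_def act_left_id J_arrows arrows_J)
  next
    case (4 g)
    then have "cv g \<odot> (g \<odot> base x y) = base x y"
      using b act_left_cancel(1)[of g x "base x y" y] by (simp add: stabL_def)
    then show ?case using 4 b by (simp add: stabL_def inv_vertex_group cv_arrows)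
  qed
  fix g h assume g: "g \<in> carrier (vertex_group x)" and h: "h \<in> stabL x y"
  \<comment> \<open>The conjugate fixes the base atom because \<open>h\<close> fixes every parallel
    arrow, in particular \<open>cv g \<odot> base x y\<close>.\<close>
  have "((g \<odot> h) \<odot> cv g) \<odot> base x y = g \<odot> (h \<odot> (cv g \<odot> base x y))"
    using g h b act_left_assoc[of "g \<odot> h" x "cv g" "base x y" y]
      act_left_assoc[of g x h "cv g \<odot> base x y" y]
    by (simp add: stabL_arrows act_left cv_arrows)
  also have "\<dots> = base x y"
    using g h b xy by (simp add: stabL_fixes act_left cv_arrows act_left_cancel)
  finally show "g \<otimes>\<^bsub>vertex_group x\<^esub> h \<otimes>\<^bsub>vertex_group x\<^esub> inv\<^bsub>vertex_group x\<^esub> g \<in> stabL x y"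
    using g h b by (simp add: stabL_def inv_vertex_group act_left cv_arrows)
qed

text \<open>Converse turns left stabilizers into right ones, and the choice of base atoms respects
  converse.\<close>

lemma stabL_sym:
  assumes xy: "(x, y) \<in> connected"
  shows "stabL y x = stabR x y"
proof -
  have b: "base x y \<in> arrows x y" using base_arrows xy .
  have "h \<odot> cv (base x y) = cv (base x y) \<longleftrightarrow> base x y \<odot> h = base x y" if h: "h \<in> arrows y y" for h
  proof -
    have "h \<odot> cv (base x y) = cv (base x y) \<longleftrightarrow> base x y \<odot> cv h = base x y"
      using cv_act_right[OF b cv_arrows[OF h]] cv_cv[OF arrows_At[OF h]] cv_cv[OF arrows_At[OF b]]
        cv_cv[OF arrows_At[OF act_right[OF b cv_arrows[OF h]]]] by metis
    also have "\<dots> \<longleftrightarrow> base x y \<odot> h = base x y"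
      using act_right_cancel[OF b h] by metis
    finally show ?thesis .
  qed
  then show ?thesis
    using xy by (auto simp: stabL_def stabR_def base_sym)
qed

lemma stabR_sym: "(x, y) \<in> connected \<Longrightarrow> stabR y x = stabL x y"
  by (simp add: connected_sym stabL_sym)

text \<open>The orbit-stabilizer correspondence: two elements lie in the same coset exactly when
  they move the base atom to the same arrow.\<close>

lemma r_coset_stabL:
  assumes xy: "(x, y) \<in> connected" and g: "g \<in> arrows x x"
  shows "stabL x y #>\<^bsub>vertex_group x\<^esub> g = cosL x y (g \<odot> base x y)"
proof -
  have b: "base x y \<in> arrows x y" using base_arrows xy .
  have "\<exists>h\<in>stabL x y. g' = h \<odot> g" if "g' \<in> cosL x y (g \<odot> base x y)" for g'
  proof
    have g': "g' \<in> arrows x x" "g' \<odot> base x y = g \<odot> base x y"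
      using that by (auto simp: cosL_def)
    show "g' = (g' \<odot> cv g) \<odot> g"
      using g' g by (simp add: act_right_cancel)
    have "(g' \<odot> cv g) \<odot> (g \<odot> base x y) = g \<odot> base x y"
      using act_left_assoc[OF g'(1) cv_arrows[OF g] act_left[OF g b]] act_left_cancel(1)[OF g b] g'(2)
      by simp
    then show "g' \<odot> cv g \<in> stabL x y"
      using g' g b xy by (intro stabL_I[of _ "g \<odot> base x y"]) (auto simp: act_left cv_arrows)
  qed
  moreover have "h \<odot> g \<in> cosL x y (g \<odot> base x y)" if "h \<in> stabL x y" for h
    using that g b xy act_left_assoc[of h x g "base x y" y]
    by (simp add: cosL_def stabL_arrows act_left stabL_fixes)
  ultimately show ?thesis
    unfolding r_coset_def vertex_group_simps by blast
qed

lemma r_coset_stabR: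
  assumes xy: "(x, y) \<in> connected" and k: "k \<in> arrows y y"
  shows "stabR x y #>\<^bsub>vertex_group y\<^esub> k = cosR x y (base x y \<odot> k)"
proof -
  have b: "base x y \<in> arrows x y" using base_arrows xy .
  have "\<exists>h\<in>stabR x y. k' = h \<odot> k" if "k' \<in> cosR x y (base x y \<odot> k)" for k'
  proof
    have k': "k' \<in> arrows y y" "base x y \<odot> k' = base x y \<odot> k"
      using that by (auto simp: cosR_def)
    show "k' = (k' \<odot> cv k) \<odot> k"
      using k' k by (simp add: act_right_cancel)
    have "base x y \<odot> (k' \<odot> cv k) = base x y"
      using k' k b by (simp add: cv_arrows act_right_cancel flip: act_right_assoc)
    then show "k' \<odot> cv k \<in> stabR x y"
      using k' k b xy by (intro stabR_I) (auto simp: act_left cv_arrows)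
  qed
  moreover have "h \<odot> k \<in> cosR x y (base x y \<odot> k)" if "h \<in> stabR x y" for h
    using that k b xy
    by (simp add: cosR_def stabR_arrows act_left stabR_fixes flip: act_right_assoc)
  ultimately show ?thesis
    unfolding r_coset_def vertex_group_simps by blast
qed

lemma rcosets_stabL:
  assumes xy: "(x, y) \<in> connected"
  shows "rcosets\<^bsub>vertex_group x\<^esub> stabL x y = cosL x y ` arrows x y"
proof -
  have b: "base x y \<in> arrows x y" using base_arrows xy .
  then have "arrows x y = (\<lambda>g. g \<odot> base x y) ` arrows x x"
    using transitive_left act_left by blast
  then show ?thesis
    using xy by (auto simp: RCOSETS_def r_coset_stabL image_image)
qed

lemma rcosets_stabR:
  assumes xy: "(x, y) \<in> connected"
  shows "rcosets\<^bsub>vertex_group y\<^esub> stabR x y = cosR x y ` arrows x y"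
proof -
  have b: "base x y \<in> arrows x y" using base_arrows xy .
  then have "arrows x y = (\<lambda>k. base x y \<odot> k) ` arrows y y"
    using transitive_right act_right by blast
  then show ?thesis
    using xy by (auto simp: RCOSETS_def r_coset_stabR image_image)
qed

section \<open>Labelled cosets and the quotient isomorphisms\<close>

lemma cosL_nonempty: "\<lbrakk>b \<in> arrows x y; (x, y) \<in> connected\<rbrakk> \<Longrightarrow> \<exists>g. g \<in> cosL x y b"
  using transitive_left[OF base_arrows] by (fastforce simp: cosL_def)

lemma cosR_nonempty: "\<lbrakk>b \<in> arrows x y; (x, y) \<in> connected\<rbrakk> \<Longrightarrow> \<exists>k. k \<in> cosR x y b"
  using transitive_right[OF base_arrows] by (fastforce simp: cosR_def)

lemma phi_cosL: "\<lbrakk>b \<in> arrows x y; (x, y) \<in> connected\<rbrakk> \<Longrightarrow> phi x y (cosL x y b) = cosR x y b"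
  using cosL_nonempty[of b x y] by (auto simp: phi_def cosL_def cosR_def)

lemma cosR_inj: "\<lbrakk>cosR x y b = cosR x y c; b \<in> arrows x y; (x, y) \<in> connected\<rbrakk> \<Longrightarrow> b = c"
  using cosR_nonempty[of b x y] by (auto simp: cosR_def)

text \<open>An element \<open>p\<close> agreeing with \<open>g\<close> on the base atom agrees with
  it on \<open>c\<close> (\<open>left_eq_transfer\<close>), so the label of the product depends on
  the two cosets alone.\<close>

lemma set_mult_cosL:
  assumes xy: "(x, y) \<in> connected" and g: "g \<in> arrows x x" and c: "c \<in> arrows x y"
  shows "cosL x y (g \<odot> base x y) <#>\<^bsub>vertex_group x\<^esub> cosL x y c = cosL x y (g \<odot> c)"
proof -
  have b: "base x y \<in> arrows x y" using base_arrows xy .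
  have "p \<odot> q \<in> cosL x y (g \<odot> c)"
    if "p \<in> cosL x y (g \<odot> base x y)" "q \<in> cosL x y c" for p q
    using that g b c left_eq_transfer[of p "base x y" g x y c]
    by (auto simp: cosL_def act_left act_left_assoc)
  moreover have "\<exists>p\<in>cosL x y (g \<odot> base x y). \<exists>q\<in>cosL x y c. r = p \<odot> q"
    if "r \<in> cosL x y (g \<odot> c)" for r
  proof (intro bexI)
    show "r = g \<odot> (cv g \<odot> r)"
      using that g act_left_cancel(2)[of g x r x] by (simp add: cosL_def)
    show "cv g \<odot> r \<in> cosL x y c"
      using that g c act_left_assoc[of "cv g" x r "base x y" y] b
      by (auto simp: cosL_def act_left cv_arrows act_left_cancel)
    show "g \<in> cosL x y (g \<odot> base x y)"
      using g by (simp add: cosL_def)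
  qed
  ultimately show ?thesis
    unfolding set_mult_def vertex_group_simps by blast
qed

lemma set_mult_cosR:
  assumes xy: "(x, y) \<in> connected" and k: "k \<in> arrows y y" and c: "c \<in> arrows x y"
  shows "cosR x y c <#>\<^bsub>vertex_group y\<^esub> cosR x y (base x y \<odot> k) = cosR x y (c \<odot> k)"
proof -
  have b: "base x y \<in> arrows x y" using base_arrows xy .
  have "p \<odot> q \<in> cosR x y (c \<odot> k)"
    if "p \<in> cosR x y c" "q \<in> cosR x y (base x y \<odot> k)" for p q
    using that k b c right_eq_transfer[of "base x y" q k y x c]
    by (auto simp: cosR_def act_right simp flip: act_right_assoc)
  moreover have "\<exists>p\<in>cosR x y c. \<exists>q\<in>cosR x y (base x y \<odot> k). r = p \<odot> q"
    if "r \<in> cosR x y (c \<odot> k)" for r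
  proof (intro bexI)
    show "r = (r \<odot> cv k) \<odot> k"
      using that k act_right_cancel(2)[of r y y k] by (simp add: cosR_def)
    show "r \<odot> cv k \<in> cosR x y c"
      using that k b c
      by (auto simp: cosR_def act_right cv_arrows act_right_cancel simp flip: act_right_assoc)
    show "k \<in> cosR x y (base x y \<odot> k)"
      using k by (simp add: cosR_def)
  qed
  ultimately show ?thesis
    unfolding set_mult_def vertex_group_simps by blast
qed

text \<open>With \<open>b = g \<odot> base x y\<close> and \<open>c = base x y \<odot> k\<close>,
  the product on the left has label \<open>g \<odot> c\<close> and the one on the right
  \<open>b \<odot> k\<close>. These coincide because the actions commute.\<close>

lemma phi_set_mult:
  assumes xy: "(x, y) \<in> connected" and b: "b \<in> arrows x y" and c: "c \<in> arrows x y"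
  shows "phi x y (cosL x y b <#>\<^bsub>vertex_group x\<^esub> cosL x y c) =
    cosR x y b <#>\<^bsub>vertex_group y\<^esub> cosR x y c"
proof -
  note a = base_arrows[OF xy]
  obtain g k where g: "g \<in> arrows x x" "b = g \<odot> base x y"
    and k: "k \<in> arrows y y" "c = base x y \<odot> k"
    using transitive_left[OF a b] transitive_right[OF a c] by blast
  then have "g \<odot> c = b \<odot> k"
    using a act_middle_assoc by simp
  then show ?thesis
    using set_mult_cosL[OF xy g(1) c] set_mult_cosR[OF xy k(1) b] g k b xy act_right
    by (simp add: phi_cosL)
qed

lemma phi_iso:
  assumes xy: "(x, y) \<in> connected"
  shows "phi x y \<in> iso (vertex_group x Mod stabL x y) (vertex_group y Mod stabR x y)"
proof -
  have "bij_betw (phi x y) (cosL x y ` arrows x y) (cosR x y ` arrows x y)"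
    unfolding bij_betw_def
    using xy by (auto intro!: inj_onI simp: phi_cosL image_image dest: cosR_inj)
  moreover have "phi x y \<in> hom (vertex_group x Mod stabL x y) (vertex_group y Mod stabR x y)"
    using xy by (auto simp: hom_def FactGroup_def rcosets_stabL rcosets_stabR phi_cosL phi_set_mult)
  ultimately show ?thesis
    using xy by (simp add: iso_def FactGroup_def rcosets_stabL rcosets_stabR)
qed

lemma phi_inv_cosR:
  assumes xy: "(x, y) \<in> connected" and b: "b \<in> arrows x y"
  shows "gt_phi_inv frame x y (cosR x y b) = cosL x y b"
proof -
  have "inj_on (phi x y) (rcosets\<^bsub>vertex_group x\<^esub> stabL x y)"
    using phi_iso[OF xy] by (auto simp: iso_def bij_betw_def FactGroup_def)
  then show ?thesis
    using inv_into_f_f[of "phi x y" "rcosets\<^bsub>vertex_group x\<^esub> stabL x y" "cosL x y b"] xy b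
    by (simp add: gt_phi_inv_def rcosets_stabL phi_cosL)
qed

lemma phi_sym_cosR:
  assumes xy: "(x, y) \<in> connected" and b: "b \<in> arrows x y"
  shows "phi y x (cosR x y b) = cosL x y b"
proof -
  define a where "a = base x y"
  have a: "a \<in> arrows x y" using base_arrows xy a_def by simp
  \<comment> \<open>The relation defining \<open>phi y x\<close> at the base atom
    \<open>cv a\<close> is the one defining \<open>phi x y\<close> at \<open>a\<close>, read
    backwards.\<close>
  have *: "k \<odot> cv a = cv a \<odot> g \<longleftrightarrow> a \<odot> k = g \<odot> a"
    if k: "k \<in> arrows y y" and g: "g \<in> arrows x x" for k g
  proof -
    have "k \<odot> cv a = cv a \<odot> g \<longleftrightarrow> cv (k \<odot> cv a) = cv (cv a \<odot> g)"
      using cv_cv[OF arrows_At[OF act_left[OF k cv_arrows[OF a]]]]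
        cv_cv[OF arrows_At[OF act_right[OF cv_arrows[OF a] g]]] by metis
    also have "\<dots> \<longleftrightarrow> a \<odot> cv k = cv g \<odot> a"
      using k g a cv_cv[OF arrows_At[OF a]]
      by (simp add: cv_act_left[of k y "cv a" x] cv_act_right[of "cv a" y x g] cv_arrows)
    also have "\<dots> \<longleftrightarrow> g \<odot> (a \<odot> cv k) = a"
      using act_left_cancel(2)[OF g a] act_left_cancel(1)[OF g act_right[OF a cv_arrows[OF k]]]
      by metis
    also have "\<dots> \<longleftrightarrow> g \<odot> a = a \<odot> k"
      using act_middle_assoc[OF g a cv_arrows[OF k]] act_right_cancel(1)[OF a k]
        act_right_cancel(2)[OF act_left[OF g a] k] by metis
    finally show ?thesis by (simp add: eq_commute)
  qed
  have "phi y x (cosR x y b) = {g \<in> arrows x x. \<exists>k\<in>cosR x y b. a \<odot> k = g \<odot> a}"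
    using * xy by (auto simp: phi_def base_sym cosR_def a_def)
  also have "\<dots> = cosL x y b"
    using cosR_nonempty[OF b xy] by (auto simp: cosR_def cosL_def a_def)
  finally show ?thesis .
qed

section \<open>The semi-frame axioms\<close>

definition stab2 :: "'a \<Rightarrow> 'a \<Rightarrow> 'a \<Rightarrow> 'a set" where
  "stab2 x y z = stabL x y <#>\<^bsub>vertex_group x\<^esub> stabL x z"

text \<open>\<open>H\<^sub>x\<^sub>y H\<^sub>x\<^sub>z\<close> is the stabilizer of the set of atoms below \<open>a ; b\<close>.\<close>

lemma stab2_iff:
  assumes xy: "(x, y) \<in> connected" and yz: "(y, z) \<in> connected"
    and a: "a \<in> arrows x y" and b: "b \<in> arrows y z" and T: "T a b c" and g: "g \<in> arrows x x"
  shows "g \<in> stab2 x y z \<longleftrightarrow> T a b (g \<odot> c)"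
proof
  have xz: "(x, z) \<in> connected" using connected_trans xy yz .
  have c: "c \<in> arrows x z" using T_arrows(2) T a b .
  {
    assume "g \<in> stab2 x y z"
    then obtain h h' where h: "h \<in> stabL x y" "h' \<in> stabL x z" "g = h \<odot> h'"
      by (auto simp: stab2_def set_mult_def)
    then have "g \<odot> c = h \<odot> c"
      using act_left_assoc[of h x h' c z] c xz by (simp add: stabL_arrows stabL_fixes)
    moreover have "T (h \<odot> a) b (h \<odot> c)"
      using T_act_left[OF T stabL_arrows[OF h(1)] a b] .
    ultimately show "T a b (g \<odot> c)"
      using h a xy by (simp add: stabL_fixes)
  }
  assume "T a b (g \<odot> c)"
  \<comment> \<open>The orbit lemma splits off a factor \<open>h\<close> fixing \<open>a\<close>;
    the remaining factor \<open>cv h \<odot> g\<close> fixes \<open>c\<close>.\<close>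
  then obtain h where h: "h \<in> arrows x x" "h \<odot> a = a" "g \<odot> c = h \<odot> c"
    using T_orbit_left[OF T _ a b] by blast
  have "cv h \<odot> g \<in> stabL x z"
    using act_left_assoc[of "cv h" x g c z] act_left_cancel(1)[of h x c z] h g c xz
    by (intro stabL_I[of _ c]) (auto simp: act_left cv_arrows)
  moreover have "g = h \<odot> (cv h \<odot> g)"
    using act_left_cancel(2)[of h x g x] h g by simp
  ultimately show "g \<in> stab2 x y z"
    using stabL_I[OF h(2,1) a xy] by (auto simp: stab2_def set_mult_def)
qed

text \<open>Counterpart of \<open>stab2_iff\<close> in the middle group:
  \<open>T_orbit_middle\<close> splits off a factor fixing \<open>a\<close>, and what remains fixes
  \<open>b\<close>.\<close>

lemma stab2R_iff:
  assumes xy: "(x, y) \<in> connected" and yz: "(y, z) \<in> connected"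
    and a: "a \<in> arrows x y" and b: "b \<in> arrows y z" and T: "T a b c" and k: "k \<in> arrows y y"
  shows "k \<in> stabR x y <#>\<^bsub>vertex_group y\<^esub> stabL y z \<longleftrightarrow> T a (k \<odot> b) c"
proof
  {
    assume "k \<in> stabR x y <#>\<^bsub>vertex_group y\<^esub> stabL y z"
    then obtain h h' where h: "h \<in> stabR x y" "h' \<in> stabL y z" "k = h \<odot> h'"
      by (auto simp: set_mult_def)
    then have "k \<odot> b = h \<odot> b"
      using act_left_assoc[of h y h' b z] b yz by (simp add: stabL_arrows stabR_arrows stabL_fixes)
    then show "T a (k \<odot> b) c"
      using T_act_middle[OF a stabR_arrows[OF h(1)] b] stabR_fixes[OF h(1) a xy] T by simp
  }
  assume "T a (k \<odot> b) c"
  then obtain h where h: "h \<in> arrows y y" "a \<odot> h = a" "k \<odot> b = h \<odot> b"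
    using T_orbit_middle[OF T _ a b] by blast
  have "cv h \<odot> k \<in> stabL y z"
    using act_left_assoc[of "cv h" y k b z] act_left_cancel(1)[of h y b z] h k b yz
    by (intro stabL_I[of _ b]) (auto simp: act_left cv_arrows)
  moreover have "k = h \<odot> (cv h \<odot> k)"
    using act_left_cancel(2)[of h y k y] h k by simp
  ultimately show "k \<in> stabR x y <#>\<^bsub>vertex_group y\<^esub> stabL y z"
    using stabR_I[OF h(2,1) a xy] by (auto simp: set_mult_def)
qed

lemma stab2R_arrows: "k \<in> stabR x y <#>\<^bsub>vertex_group y\<^esub> stabL y z \<Longrightarrow> k \<in> arrows y y"
  by (auto simp: set_mult_def act_left stabL_arrows stabR_arrows)

lemma normal_stab2:
  "\<lbrakk>(x, y) \<in> connected; (y, z) \<in> connected\<rbrakk> \<Longrightarrow> stab2 x y z \<lhd> vertex_group x"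
  unfolding stab2_def
  using group.normal_subgroup_set_mult_closed[OF group_vertex_group]
  by (simp add: normal_stabL connected_trans[of x y z] connected_J)

text \<open>Cosets of the product thus become solution sets of a triangle condition, the form in
  which offsets and the sets \<open>D\<close> are handled below.\<close>

lemma r_coset_stab2:
  assumes xy: "(x, y) \<in> connected" and yz: "(y, z) \<in> connected"
    and a: "a \<in> arrows x y" and b: "b \<in> arrows y z" and T: "T a b (g \<odot> c)"
    and c: "c \<in> arrows x z" and g: "g \<in> arrows x x"
  shows "stab2 x y z #>\<^bsub>vertex_group x\<^esub> g = {g' \<in> arrows x x. T a b (g' \<odot> c)}"
proof -
  interpret normal "stab2 x y z" "vertex_group x"
    using normal_stab2 xy yz .
  have "h \<odot> g \<in> arrows x x \<and> T a b ((h \<odot> g) \<odot> c)" if "h \<in> stab2 x y z" for h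
  proof -
    have "h \<in> arrows x x" using subset that by auto
    then show ?thesis
      using stab2_iff[OF xy yz a b T] that g c act_left_assoc[of h x g c z] act_left[of h x g x]
      by simp
  qed
  moreover have "\<exists>h\<in>stab2 x y z. g' = h \<odot> g" if g': "g' \<in> arrows x x" "T a b (g' \<odot> c)" for g'
  proof
    show "g' = (g' \<odot> cv g) \<odot> g"
      using act_right_cancel(2)[of g' x x g] g g' by simp
    have "(g' \<odot> cv g) \<odot> (g \<odot> c) = g' \<odot> c"
      using act_left_assoc[OF g'(1) cv_arrows[OF g] act_left[OF g c]] act_left_cancel(1)[OF g c]
      by simp
    then show "g' \<odot> cv g \<in> stab2 x y z"
      using stab2_iff[OF xy yz a b T] g' g by (simp add: act_left cv_arrows)
  qed
  ultimately show ?thesis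
    unfolding r_coset_def vertex_group_simps by blast
qed

text \<open>Any member \<open>g\<close> may represent \<open>D\<close>, and any triangle ending in
  \<open>g \<odot> c\<close> describes it. Later \<open>b\<close> is varied while \<open>D\<close>
  stays fixed.\<close>

lemma rcosets_stab2_mem:
  assumes xy: "(x, y) \<in> connected" and yz: "(y, z) \<in> connected"
    and D: "D \<in> rcosets\<^bsub>vertex_group x\<^esub> stab2 x y z" and gD: "g \<in> D"
    and a: "a \<in> arrows x y" and b: "b \<in> arrows y z" and T: "T a b (g \<odot> c)"
    and c: "c \<in> arrows x z"
  shows "g \<in> arrows x x" and "D = {g' \<in> arrows x x. T a b (g' \<odot> c)}"
proof -
  interpret normal "stab2 x y z" "vertex_group x"
    using normal_stab2 xy yz .
  obtain g0 where g0: "g0 \<in> arrows x x" "D = stab2 x y z #>\<^bsub>vertex_group x\<^esub> g0"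
    using D by (auto simp: RCOSETS_def)
  then have "D \<subseteq> arrows x x"
    using r_coset_subset_G[of "stab2 x y z" g0] subset by simp
  then show g: "g \<in> arrows x x" using gD by blast
  have "D = stab2 x y z #>\<^bsub>vertex_group x\<^esub> g"
    using repr_independence[of g "stab2 x y z" g0] g0 gD subgroup_axioms by simp
  then show "D = {g' \<in> arrows x x. T a b (g' \<odot> c)}"
    using r_coset_stab2[OF xy yz a b T c g] by simp
qed

section \<open>Offsets and images of unions of cosets\<close>

lemma offset_ex:
  assumes xy: "(x, y) \<in> connected" and yz: "(y, z) \<in> connected"
  shows "\<exists>g. g \<in> offset x y z"
proof -
  have xz: "(x, z) \<in> connected" using connected_trans xy yz .
  obtain c where c: "T (base x y) (base y z) c"
    using T_ex base_arrows xy yz by blast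
  then have "c \<in> arrows x z"
    using T_arrows(2) base_arrows xy yz by blast
  then show ?thesis
    using c transitive_left[OF base_arrows[OF xz]] by (auto simp: offset_def)
qed

lemma offset_coset:
  assumes xy: "(x, y) \<in> connected" and yz: "(y, z) \<in> connected"
  shows "offset x y z \<in> rcosets\<^bsub>vertex_group x\<^esub> stab2 x y z"
proof -
  have xz: "(x, z) \<in> connected" using connected_trans xy yz .
  obtain g where g: "g \<in> arrows x x" "T (base x y) (base y z) (g \<odot> base x z)"
    using offset_ex[OF assms] by (auto simp: offset_def)
  then have "stab2 x y z #>\<^bsub>vertex_group x\<^esub> g = offset x y z"
    using r_coset_stab2[OF xy yz base_arrows[OF xy] base_arrows[OF yz] g(2) base_arrows[OF xz] g(1)]
    by (simp add: offset_def)
  then show ?thesis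
    using g by (auto simp: RCOSETS_def)
qed

text \<open>The premise \<open>closed\<close> says that \<open>N\<close> is a union of cosets;
  membership in the image can then be tested on a single representative.\<close>

lemma gt_image_iff:
  assumes xy: "(x, y) \<in> connected"
    and closed: "\<And>g g'. \<lbrakk>g \<in> N; g' \<in> arrows x x; g' \<odot> base x y = g \<odot> base x y\<rbrakk> \<Longrightarrow> g' \<in> N"
    and N: "N \<subseteq> arrows x x"
  shows "k \<in> gt_image frame x y N \<longleftrightarrow>
    k \<in> arrows y y \<and> (\<exists>g\<in>N. g \<odot> base x y = base x y \<odot> k)"
proof -
  note a = base_arrows[OF xy]
  have "gt_image frame x y N = (\<Union>b\<in>{b \<in> arrows x y. cosL x y b \<subseteq> N}. cosR x y b)"
    unfolding gt_image_def frame_simps rcosets_stabL[OF xy]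
    using xy by (auto simp: phi_cosL)
  then have "k \<in> gt_image frame x y N \<longleftrightarrow>
      k \<in> arrows y y \<and> cosL x y (base x y \<odot> k) \<subseteq> N"
    using a act_right by (auto simp: cosR_def)
  also have "\<dots> \<longleftrightarrow> k \<in> arrows y y \<and> (\<exists>g\<in>N. g \<odot> base x y = base x y \<odot> k)"
  proof (rule conj_cong[OF refl])
    assume k: "k \<in> arrows y y"
    obtain g where "g \<in> cosL x y (base x y \<odot> k)"
      using cosL_nonempty[OF act_right[OF a k] xy] by blast
    then show "cosL x y (base x y \<odot> k) \<subseteq> N \<longleftrightarrow> (\<exists>g\<in>N. g \<odot> base x y = base x y \<odot> k)"
      using closed N by (auto simp: cosL_def)
  qed
  finally show ?thesis .
qed

text \<open>If \<open>g\<close> on the left of the base atom equals \<open>k\<close> on its right,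
  then acting by \<open>g\<close> on a triangle amounts to inserting \<open>k\<close> in its middle.
  This matches \<open>stab2_iff\<close> with \<open>stab2R_iff\<close>.\<close>

lemma gt_image_stab2:
  assumes xy: "(x, y) \<in> connected" and yz: "(y, z) \<in> connected"
  shows "gt_image frame x y (stab2 x y z) = stabR x y <#>\<^bsub>vertex_group y\<^esub> stabL y z"
proof -
  note a = base_arrows[OF xy] and b = base_arrows[OF yz]
  obtain c where T: "T (base x y) (base y z) c"
    using T_ex a b by blast
  have c: "c \<in> arrows x z" using T_arrows(2) T a b .
  interpret S: normal "stab2 x y z" "vertex_group x"
    using normal_stab2 xy yz .
  have T': "T (base x y) (k \<odot> base y z) (g \<odot> c)"
    if "g \<in> arrows x x" "k \<in> arrows y y" "g \<odot> base x y = base x y \<odot> k" for g k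
    using T_act_left[OF T that(1) a b] T_act_middle[OF a that(2) b] that(3) by simp
  \<comment> \<open>Both \<open>g\<close> and \<open>g'\<close> correspond to the same
    \<open>k\<close>, so one triangle with middle factor \<open>k \<odot> base y z\<close> describes
    their coset.\<close>
  have closed: "g' \<in> stab2 x y z"
    if g: "g \<in> stab2 x y z" and g': "g' \<in> arrows x x" "g' \<odot> base x y = g \<odot> base x y" for g g'
  proof -
    have gx: "g \<in> arrows x x" using S.subset g by auto
    obtain k where k: "k \<in> arrows y y" "g \<odot> base x y = base x y \<odot> k"
      using transitive_right[OF a act_left[OF gx a]] by blast
    have "T (base x y) (k \<odot> base y z) (g \<odot> c)" "T (base x y) (k \<odot> base y z) (g' \<odot> c)"
      using T' gx g' k by simp_all
    moreover have "stab2 x y z \<in> rcosets\<^bsub>vertex_group x\<^esub> stab2 x y z"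
      using S.subgroup_in_rcosets[OF S.is_group] .
    ultimately show ?thesis
      using rcosets_stab2_mem(2)[OF xy yz _ g a act_left[OF k(1) b] _ c] g'(1) by blast
  qed
  have "k \<in> gt_image frame x y (stab2 x y z) \<longleftrightarrow>
    k \<in> stabR x y <#>\<^bsub>vertex_group y\<^esub> stabL y z" for k
  proof -
    have "k \<in> gt_image frame x y (stab2 x y z) \<longleftrightarrow>
        k \<in> arrows y y \<and> (\<exists>g\<in>stab2 x y z. g \<odot> base x y = base x y \<odot> k)"
      using S.subset by (intro gt_image_iff[OF xy]) (auto intro: closed)
    also have "\<dots> \<longleftrightarrow> k \<in> arrows y y \<and> T (base x y) (k \<odot> base y z) c"
    proof (rule conj_cong[OF refl])
      assume k: "k \<in> arrows y y"
      obtain g where g: "g \<in> arrows x x" "base x y \<odot> k = g \<odot> base x y"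
        using transitive_left[OF a act_right[OF a k]] by blast
      have Tk: "T (base x y) (k \<odot> base y z) (h \<odot> c)"
        if "h \<in> arrows x x" "h \<odot> base x y = base x y \<odot> k" for h
        using T' that k by blast
      \<comment> \<open>Forwards, \<open>stab2R_iff\<close> is applied with third atom
        \<open>h \<odot> c\<close> and then with \<open>c\<close>. Backwards,
        \<open>stab2_iff\<close> is applied with second atom \<open>k \<odot> base y z\<close>,
        which the group \<open>stab2 x y z\<close> does not notice.\<close>
      show "(\<exists>g\<in>stab2 x y z. g \<odot> base x y = base x y \<odot> k) \<longleftrightarrow> T (base x y) (k \<odot> base y z) c"
      proof
        assume "\<exists>g\<in>stab2 x y z. g \<odot> base x y = base x y \<odot> k"
        then obtain h where h: "h \<in> stab2 x y z" "h \<odot> base x y = base x y \<odot> k" by blast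
        have hx: "h \<in> arrows x x" using S.subset h by auto
        have "T (base x y) (base y z) (h \<odot> c)"
          using stab2_iff[OF xy yz a b T hx] h by simp
        then have "k \<in> stabR x y <#>\<^bsub>vertex_group y\<^esub> stabL y z"
          using stab2R_iff[OF xy yz a b _ k] Tk[OF hx h(2)] by blast
        then show "T (base x y) (k \<odot> base y z) c"
          using stab2R_iff[OF xy yz a b T k] by blast
      next
        assume "T (base x y) (k \<odot> base y z) c"
        then have "g \<in> stab2 x y z"
          using stab2_iff[OF xy yz a act_left[OF k b] _ g(1)] Tk g by simp
        then show "\<exists>g\<in>stab2 x y z. g \<odot> base x y = base x y \<odot> k"
          using g by auto
      qed
    qed
    also have "\<dots> \<longleftrightarrow> k \<in> stabR x y <#>\<^bsub>vertex_group y\<^esub> stabL y z"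
      using stab2R_iff[OF xy yz a b T] stab2R_arrows by blast
    finally show ?thesis .
  qed
  then show ?thesis by blast
qed

text \<open>Membership of \<open>m\<close> means on the left a chain \<open>g\<close>,
  \<open>k\<close>, \<open>m\<close> of corresponding elements with \<open>g \<in> D\<close>, and on
  the right an element \<open>cv c \<odot> g \<odot> c'\<close> corresponding to \<open>m\<close>.
  The link is that \<open>g \<odot> (c' \<odot> ?e)\<close> and
  \<open>c \<odot> (n \<odot> ?e)\<close> name the same atom, \<open>n\<close> corresponding to
  \<open>m\<close>.\<close>

lemma gt_image_comp:
  assumes xy: "(x, y) \<in> connected" and yz: "(y, z) \<in> connected"
    and D: "D \<in> rcosets\<^bsub>vertex_group x\<^esub> stab2 x y z"
  shows "gt_image frame y z (gt_image frame x y D) =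
    gt_image frame x z {cv c \<odot> g \<odot> c' |c g c'. c \<in> offset x y z \<and> g \<in> D \<and> c' \<in> offset x y z}"
    (is "_ = gt_image frame x z ?N")
proof -
  have xz: "(x, z) \<in> connected" using connected_trans xy yz .
  let ?a = "base x y" and ?b = "base y z" and ?e = "base x z"
  note a = base_arrows[OF xy] and b = base_arrows[OF yz] and e = base_arrows[OF xz]
  obtain c0 where T: "T ?a ?b c0"
    using T_ex a b by blast
  have c0: "c0 \<in> arrows x z" using T_arrows(2) T a b .
  interpret S: normal "stab2 x y z" "vertex_group x"
    using normal_stab2 xy yz .
  have Dx: "D \<subseteq> arrows x x"
    using S.rcosets_part_G[OF S.subgroup_axioms] D by auto
  have T': "T ?a (k \<odot> ?b) (g \<odot> d)"
    if "T ?a ?b d" "g \<in> arrows x x" "k \<in> arrows y y" "g \<odot> ?a = ?a \<odot> k" for g k d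
    using T_act_left[OF that(1,2) a b] T_act_middle[OF a that(3) b] that(4) by simp
  \<comment> \<open>\<open>D\<close> absorbs changes of \<open>k\<close> that are invisible on the
    base atom of \<open>(y, z)\<close>. This makes both \<open>D\<close> and its first image unions
    of cosets.\<close>
  have D_closed: "g' \<in> D"
    if g: "g \<in> D" "g \<odot> ?a = ?a \<odot> k" and g': "g' \<in> arrows x x" "g' \<odot> ?a = ?a \<odot> k'"
      and k: "k \<in> arrows y y" "k' \<in> arrows y y" "k' \<odot> ?b = k \<odot> ?b" for g g' k k'
  proof -
    have gx: "g \<in> arrows x x" using Dx g by blast
    have "T ?a (k \<odot> ?b) (g \<odot> c0)" "T ?a (k \<odot> ?b) (g' \<odot> c0)"
      using T'[OF T gx k(1) g(2)] T'[OF T g'(1) k(2) g'(2)] k(3) by simp_all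
    then show ?thesis
      using rcosets_stab2_mem(2)[OF xy yz D g(1) a act_left[OF k(1) b] _ c0] g'(1) by blast
  qed
  have closed1: "g' \<in> D" if g: "g \<in> D" "g' \<in> arrows x x" "g' \<odot> ?a = g \<odot> ?a" for g g'
  proof -
    obtain k where k: "k \<in> arrows y y" "g \<odot> ?a = ?a \<odot> k"
      using transitive_right[OF a act_left[OF _ a]] g Dx by blast
    then show ?thesis using D_closed[OF g(1) k(2) g(2) _ k(1,1)] g(3) by simp
  qed
  have image1: "k \<in> gt_image frame x y D \<longleftrightarrow> k \<in> arrows y y \<and> (\<exists>g\<in>D. g \<odot> ?a = ?a \<odot> k)" for k
    by (rule gt_image_iff[OF xy _ Dx]) (rule closed1)
  have closed2: "k' \<in> gt_image frame x y D"
    if k: "k \<in> gt_image frame x y D" "k' \<in> arrows y y" "k' \<odot> ?b = k \<odot> ?b" for k k'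
  proof -
    obtain g where g: "g \<in> D" "g \<odot> ?a = ?a \<odot> k" and ky: "k \<in> arrows y y"
      using k image1 by blast
    obtain g' where g': "g' \<in> arrows x x" "?a \<odot> k' = g' \<odot> ?a"
      using transitive_left[OF a act_right[OF a k(2)]] by blast
    then have "g' \<in> D"
      using D_closed[OF g g'(1) _ ky k(2,3)] by simp
    then show ?thesis using image1 g' k by auto
  qed
  have image1_sub: "gt_image frame x y D \<subseteq> arrows y y"
    using image1 by auto
  have LHS: "m \<in> gt_image frame y z (gt_image frame x y D) \<longleftrightarrow> m \<in> arrows z z \<and>
      (\<exists>k\<in>arrows y y. k \<odot> ?b = ?b \<odot> m \<and> (\<exists>g\<in>D. g \<odot> ?a = ?a \<odot> k))" for m
  proof -
    have "m \<in> gt_image frame y z (gt_image frame x y D) \<longleftrightarrow>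
        m \<in> arrows z z \<and> (\<exists>k\<in>gt_image frame x y D. k \<odot> ?b = ?b \<odot> m)"
      by (rule gt_image_iff[OF yz _ image1_sub]) (rule closed2)
    then show ?thesis unfolding Bex_def image1 by blast
  qed
  have Cx: "offset x y z \<subseteq> arrows x x" by (auto simp: offset_def)
  have Nx: "?N \<subseteq> arrows x x"
    by (auto intro!: act_left cv_arrows dest: subsetD[OF Cx] subsetD[OF Dx])
  \<comment> \<open>Cancelling \<open>cv c\<close> puts the comparison of
    \<open>?e\<close>-translates into a form that can be read in triangles.\<close>
  have move: "cv c \<odot> g \<odot> c' \<odot> ?e = n \<odot> ?e \<longleftrightarrow> g \<odot> (c' \<odot> ?e) = c \<odot> (n \<odot> ?e)"
    if "c \<in> arrows x x" "c' \<in> arrows x x" "g \<in> arrows x x" "n \<in> arrows x x" for c c' g n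
  proof -
    have "cv c \<odot> g \<odot> c' \<odot> ?e = cv c \<odot> (g \<odot> (c' \<odot> ?e))"
      using that e act_left_assoc[of "cv c \<odot> g" x c' ?e z]
        act_left_assoc[of "cv c" x g "c' \<odot> ?e" z]
      by (simp add: act_left cv_arrows)
    then show ?thesis
      using act_left_cancel[of c x "n \<odot> ?e" z] act_left_cancel[of c x "g \<odot> (c' \<odot> ?e)" z] that e
      by (metis act_left)
  qed
  have closed3: "n' \<in> ?N" if n: "n \<in> ?N" "n' \<in> arrows x x" "n' \<odot> ?e = n \<odot> ?e" for n n'
  proof -
    obtain c g c' where cgc: "n = cv c \<odot> g \<odot> c'" "c \<in> offset x y z" "g \<in> D" "c' \<in> offset x y z"
      using n by blast
    then have in_x: "c \<in> arrows x x" "g \<in> arrows x x" "c' \<in> arrows x x"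
      using Cx Dx by auto
    \<comment> \<open>The solution of \<open>n' = cv c \<odot> g \<odot> d\<close>; it replaces
      \<open>c'\<close> and moves \<open>?e\<close> to the same arrow, so it is again an
      offset.\<close>
    define d where "d = cv g \<odot> (c \<odot> n')"
    have d: "d \<in> arrows x x"
      using in_x n by (simp add: d_def act_left cv_arrows)
    have n'd: "n' = cv c \<odot> g \<odot> d"
      using in_x n(2) act_left_assoc[of "cv c" x g "cv g \<odot> (c \<odot> n')" x]
        act_left_cancel[of g x "c \<odot> n'" x] act_left_cancel[of c x n' x]
      by (simp add: d_def act_left cv_arrows)
    have "g \<odot> (d \<odot> ?e) = c \<odot> (n' \<odot> ?e)"
      using move[of c d g n'] in_x d n n'd by simp
    also have "\<dots> = g \<odot> (c' \<odot> ?e)"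
      using move[of c c' g n'] in_x n cgc by simp
    finally have "d \<odot> ?e = c' \<odot> ?e"
      using act_left_cancel(1)[of g x _ z] in_x d e act_left by metis
    then have "d \<in> offset x y z"
      using cgc(4) d by (simp add: offset_def)
    then show ?thesis using n'd cgc by blast
  qed
  have RHS: "m \<in> gt_image frame x z ?N \<longleftrightarrow> m \<in> arrows z z \<and> (\<exists>n\<in>?N. n \<odot> ?e = ?e \<odot> m)" for m
    by (rule gt_image_iff[OF xz _ Nx]) (rule closed3)
  have key: "(\<exists>k\<in>arrows y y. k \<odot> ?b = ?b \<odot> m \<and> (\<exists>g\<in>D. g \<odot> ?a = ?a \<odot> k)) \<longleftrightarrow>
      (\<exists>n\<in>?N. n \<odot> ?e = ?e \<odot> m)" if m: "m \<in> arrows z z" for m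
  proof -
    obtain n where n: "n \<in> arrows x x" "n \<odot> ?e = ?e \<odot> m"
      using transitive_left[OF e act_right[OF e m]] by metis
    \<comment> \<open>The offset triangle multiplied by \<open>m\<close> on the right, with
      \<open>m\<close> then traded for \<open>n\<close>.\<close>
    have Tm: "T ?a (?b \<odot> m) (c \<odot> (n \<odot> ?e))" if "c \<in> offset x y z" for c
    proof -
      have c: "c \<in> arrows x x" "T ?a ?b (c \<odot> ?e)"
        using that by (auto simp: offset_def)
      then have "T ?a (?b \<odot> m) ((c \<odot> ?e) \<odot> m)"
        using T_act_right[OF _ a b m] by blast
      then show ?thesis
        using act_middle_assoc[OF c(1) e m] n by simp
    qed
    show ?thesis
    proof
      assume "\<exists>k\<in>arrows y y. k \<odot> ?b = ?b \<odot> m \<and> (\<exists>g\<in>D. g \<odot> ?a = ?a \<odot> k)"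
      then obtain k g where k: "k \<in> arrows y y" "k \<odot> ?b = ?b \<odot> m"
        and g: "g \<in> D" "g \<odot> ?a = ?a \<odot> k" by blast
      have gx: "g \<in> arrows x x" using g Dx by blast
      obtain c where c: "c \<in> offset x y z" using offset_ex xy yz by blast
      have cx: "c \<in> arrows x x" using c Cx by blast
      define w where "w = c \<odot> (n \<odot> ?e)"
      have w: "w \<in> arrows x z"
        using act_left[OF cx act_left[OF n(1) e]] by (simp add: w_def)
      \<comment> \<open>Chosen so that \<open>cv c \<odot> g \<odot> c'\<close> acts on
        \<open>?e\<close> as \<open>n\<close> does; the triangle for \<open>w\<close>, pulled back
        along \<open>g\<close>, shows that it is an offset.\<close>
      define c' where "c' = cv g \<odot> (c \<odot> n)"
      have c'x: "c' \<in> arrows x x"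
        using cx gx n by (simp add: c'_def act_left cv_arrows)
      have c'e: "c' \<odot> ?e = cv g \<odot> w"
        using act_left_assoc[of "cv g" x "c \<odot> n" ?e z] act_left_assoc[of c x n ?e z] cx gx n e
        by (simp add: c'_def w_def act_left cv_arrows)
      have "T ?a (k \<odot> ?b) w"
        using Tm[OF c] k by (simp add: w_def)
      then have "T (g \<odot> ?a) ?b w"
        using T_act_middle[OF a k(1) b] g by simp
      then have "T (cv g \<odot> (g \<odot> ?a)) ?b (cv g \<odot> w)"
        using T_act_left[OF _ cv_arrows[OF gx] act_left[OF gx a] b] by blast
      then have "c' \<in> offset x y z"
        using act_left_cancel(1)[OF gx a] c'x c'e by (simp add: offset_def)
      moreover have "cv c \<odot> g \<odot> c' \<odot> ?e = n \<odot> ?e"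
        using move[OF cx c'x gx n(1)] c'e act_left_cancel(2)[OF gx w] by (simp add: w_def)
      ultimately show "\<exists>n\<in>?N. n \<odot> ?e = ?e \<odot> m"
        using c g n by auto
    next
      assume "\<exists>n\<in>?N. n \<odot> ?e = ?e \<odot> m"
      then obtain c g c' where c: "c \<in> offset x y z" "g \<in> D" "c' \<in> offset x y z"
        and eq: "cv c \<odot> g \<odot> c' \<odot> ?e = ?e \<odot> m" by blast
      have in_x: "c \<in> arrows x x" "g \<in> arrows x x" "c' \<in> arrows x x"
        using c Cx Dx by auto
      have eq': "g \<odot> (c' \<odot> ?e) = c \<odot> (n \<odot> ?e)"
        using move[of c c' g n] in_x n eq by simp
      obtain k where k: "k \<in> arrows y y" "g \<odot> ?a = ?a \<odot> k"
        using transitive_right[OF a act_left[OF in_x(2) a]] by blast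
      have "T ?a (k \<odot> ?b) (g \<odot> (c' \<odot> ?e))"
        using T' c in_x k by (auto simp: offset_def)
      moreover have "T ?a (?b \<odot> m) (g \<odot> (c' \<odot> ?e))"
        using Tm[OF c(1)] eq' by simp
      \<comment> \<open>Two triangles with the same first and third atom differ by some
        \<open>l\<close> fixing \<open>?a\<close>, so \<open>l \<odot> k\<close> corresponds to both
        \<open>g\<close> and \<open>m\<close>.\<close>
      ultimately obtain l where l: "l \<in> arrows y y" "?a \<odot> l = ?a" "?b \<odot> m = l \<odot> (k \<odot> ?b)"
        using T_orbit_middle a act_left[OF k(1) b] by blast
      have "(l \<odot> k) \<odot> ?b = ?b \<odot> m"
        using act_left_assoc[OF l(1) k(1) b] l by simp
      moreover have "g \<odot> ?a = ?a \<odot> (l \<odot> k)"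
        using act_right_assoc[OF a l(1) k(1)] l k by simp
      ultimately show "\<exists>k\<in>arrows y y. k \<odot> ?b = ?b \<odot> m \<and> (\<exists>g\<in>D. g \<odot> ?a = ?a \<odot> k)"
        using act_left[OF l(1) k(1)] c(2) by blast
    qed
  qed
  show ?thesis
    by (intro Set.set_eqI) (simp only: LHS RHS key cong: conj_cong)
qed

section \<open>Verification of the semi-frame axioms\<close>

lemma stabL_refl: "x \<in> J \<Longrightarrow> stabL x x = {x}"
  using act_right_id J_arrows act_left_id by (auto simp: stabL_def base_refl)

lemma semi_frame_frame: "semi_frame frame"
proof (intro semi_frame.intro is_group_triple.intro semi_frame_axioms.intro, goal_cases)
  case (2 x y)
  then show ?case using arrows_unique by auto
next
  case (5 x y)
  then show ?case using normal_stabL[of y x] by (simp add: connected_sym stabL_sym)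
next
  case (7 x y z)
  then show ?case using offset_coset[of x y z] by (simp add: stab2_def)
next
  case (9 x)
  then show ?case using stabL_sym[of x x] by (simp add: connected_refl stabL_refl)
next
  case (10 x \<xi>)
  have x: "(x, x) \<in> connected" using 10 by (simp add: connected_refl)
  then obtain b where b: "b \<in> arrows x x" "\<xi> = cosL x x b"
    using 10 rcosets_stabL[OF x] by (auto simp: stabL_refl)
  \<comment> \<open>The base atom of \<open>(x, x)\<close> is the unit of the group, so labels and
    group elements coincide.\<close>
  have "cosL x x b = {b}" "cosR x x b = {b}"
    using b act_right_id[of _ x x] act_left_id[of _ x x] by (auto simp: cosL_def cosR_def base_refl)
  then show ?case using phi_cosL[OF b(1) x] b by simp
next
  case (13 x y \<eta>)
  then show ?case by (auto simp: rcosets_stabR phi_sym_cosR phi_inv_cosR)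
next
  case (14 x y z)
  then show ?case using gt_image_stab2[of x y z] by (simp add: stab2_def)
next
  case (15 x y z Q D)
  then have xy: "(x, y) \<in> connected" and yz: "(y, z) \<in> connected" by auto
  interpret S: normal "stab2 x y z" "vertex_group x"
    using normal_stab2 xy yz .
  have Q: "Q = vertex_group x Mod stab2 x y z" using 15 by (simp add: stab2_def)
  have D: "D \<in> rcosets\<^bsub>vertex_group x\<^esub> stab2 x y z"
    using 15 Q by (simp add: FactGroup_def)
  \<comment> \<open>In the quotient group inverses and products are taken elementwise, which yields
    the set of triple products in \<open>gt_image_comp\<close>.\<close>
  have "inv\<^bsub>Q\<^esub> (offset x y z) = (\<Union>h\<in>offset x y z. {inv\<^bsub>vertex_group x\<^esub> h})"
    unfolding Q using S.inv_FactGroup offset_coset[OF xy yz] by (simp add: FactGroup_def SET_INV_def)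
  also have "\<dots> = (\<Union>h\<in>offset x y z. {cv h})"
    by (intro SUP_cong refl) (auto simp: inv_vertex_group offset_def)
  finally have "inv\<^bsub>Q\<^esub> (offset x y z) \<otimes>\<^bsub>Q\<^esub> D \<otimes>\<^bsub>Q\<^esub> offset x y z =
     {cv c \<odot> g \<odot> c' |c g c'. c \<in> offset x y z \<and> g \<in> D \<and> c' \<in> offset x y z}"
    by (auto simp: Q set_mult_def)
  then show ?case
    using gt_image_comp[OF xy yz D] by simp
qed (auto simp: group_vertex_group equiv_connected normal_stabL phi_iso stabL_refl stabL_sym stabR_sym)

section \<open>The isomorphism with the coset algebra\<close>

definition rho :: "'a set \<Rightarrow> ('a \<times> 'a) set" where
  "rho X = {(g, k). \<exists>x y. (x, y) \<in> connected \<and> g \<in> arrows x x \<and> k \<in> arrows y y \<and>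
     cv g \<odot> (base x y \<odot> k) \<in> X}"

lemma rho_iff:
  assumes "g \<in> arrows x x" "k \<in> arrows y y" "(x, y) \<in> connected"
  shows "(g, k) \<in> rho X \<longleftrightarrow> cv g \<odot> (base x y \<odot> k) \<in> X"
proof
  assume "(g, k) \<in> rho X"
  then obtain x' y' where xy': "g \<in> arrows x' x'" "k \<in> arrows y' y'"
      "cv g \<odot> (base x' y' \<odot> k) \<in> X"
    unfolding rho_def by blast
  then have "x' = x" "y' = y"
    using arrows_unique assms(1,2) by blast+
  then show "cv g \<odot> (base x y \<odot> k) \<in> X"
    using xy' by simp
next
  assume "cv g \<odot> (base x y \<odot> k) \<in> X"
  then show "(g, k) \<in> rho X"
    unfolding rho_def using assms by blast
qed

lemma rhoE:
  assumes "p \<in> rho X"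
  obtains x y g k where "p = (g, k)" "g \<in> arrows x x" "k \<in> arrows y y" "(x, y) \<in> connected"
    "cv g \<odot> (base x y \<odot> k) \<in> X"
  using assms by (auto simp: rho_def)

lemma act_base_arrows:
  "\<lbrakk>g \<in> arrows x x; k \<in> arrows y y; (x, y) \<in> connected\<rbrakk> \<Longrightarrow> cv g \<odot> (base x y \<odot> k) \<in> arrows x y"
  using act_left[OF cv_arrows act_right[OF base_arrows]] .

lemma arrows_connected: "b \<in> arrows x y \<Longrightarrow> (x, y) \<in> connected"
  by (auto simp: connected_def)

text \<open>The witness pairs the unit of the source group with some \<open>k\<close> such that
  \<open>b = base x y \<odot> k\<close>. Its label is \<open>b\<close>, which later yields
  injectivity of \<open>rho\<close>.\<close>

lemma rho_singleton_mem:
  assumes "b \<in> At"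
  shows "\<exists>p. p \<in> rho {b} \<and> (\<forall>X. p \<in> rho X \<longrightarrow> b \<in> X)"
proof -
  obtain x y where b: "b \<in> arrows x y" using ex_arrows assms by blast
  obtain k where k: "k \<in> arrows y y" "b = base x y \<odot> k"
    using transitive_right[OF base_arrows b] arrows_connected[OF b] by blast
  have x: "x \<in> arrows x x" "cv x = x"
    using b arrows_J J_arrows cv_J by auto
  have "(x, k) \<in> rho X \<longleftrightarrow> b \<in> X" for X
    using rho_iff[OF x(1) k(1) arrows_connected[OF b]] x k act_left_id[OF b] by simp
  then show ?thesis by blast
qed

lemma rho_singleton_subset:
  assumes "b \<in> At"
  shows "rho {b} \<subseteq> rho X \<longleftrightarrow> b \<in> X"
proof
  show "rho {b} \<subseteq> rho X \<Longrightarrow> b \<in> X"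
    using rho_singleton_mem[OF assms] by blast
  show "b \<in> X \<Longrightarrow> rho {b} \<subseteq> rho X"
    by (auto simp: rho_def)
qed

lemma rho_Union: "rho X = (\<Union>b\<in>X. rho {b})"
  by (auto simp: rho_def)

text \<open>With \<open>b = base x y \<odot> l\<close>, the relation holds of \<open>(g, k)\<close>
  when \<open>base x y \<odot> k = (g \<odot> base x y) \<odot> l\<close>. The right side is
  \<open>g \<odot> b\<close>, so cancelling \<open>g\<close> leaves the label condition.\<close>

lemma gt_R_eq_rho:
  assumes b: "b \<in> arrows x y"
  shows "gt_R frame x y (cosL x y b) = rho {b}"
proof -
  note xy = arrows_connected[OF b]
  note a = base_arrows[OF xy]
  obtain l where l: "l \<in> arrows y y" "b = base x y \<odot> l"
    using transitive_right[OF a b] by blast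
  have "gt_R frame x y (cosL x y b) =
      (\<Union>c\<in>arrows x y. cosL x y c \<times> cosR x y (c \<odot> l))"
    using set_mult_cosR[OF xy l(1)] l(2) phi_cosL[OF b xy]
    by (simp add: gt_R_def rcosets_stabL[OF xy] phi_cosL xy b)
  also have "\<dots> = {(g, k). g \<in> arrows x x \<and> k \<in> arrows y y \<and> base x y \<odot> k = (g \<odot> base x y) \<odot> l}"
    using act_left[OF _ a] by (auto simp: cosL_def cosR_def)
  also have "\<dots> = {(g, k). g \<in> arrows x x \<and> k \<in> arrows y y \<and> cv g \<odot> (base x y \<odot> k) = b}"
  proof -
    have "base x y \<odot> k = (g \<odot> base x y) \<odot> l \<longleftrightarrow> cv g \<odot> (base x y \<odot> k) = b"
      if "g \<in> arrows x x" "k \<in> arrows y y" for g k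
      using act_middle_assoc[OF that(1) a l(1)] l(2) act_left_cancel(1)[OF that(1) b]
        act_left_cancel(2)[OF that(1) act_right[OF a that(2)]] by metis
    then show ?thesis by auto
  qed
  also have "\<dots> = rho {b}"
  proof -
    have "x' = x \<and> y' = y" if "g \<in> arrows x' x'" "k \<in> arrows y' y'" "(x', y') \<in> connected"
      "cv g \<odot> (base x' y' \<odot> k) = b" for x' y' g k
      using act_base_arrows[OF that(1,2,3)] that(4) b arrows_unique by blast
    then show ?thesis
      using xy by (fastforce simp: rho_def)
  qed
  finally show ?thesis .
qed

lemma carrier_gt_algebra: "carrier (gt_algebra frame) = rho ` Pow At"
proof -
  have "gt_Rs frame = {gt_R frame x y (cosL x y b) |x y b. b \<in> arrows x y}"
    unfolding gt_Rs_def frame_simps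
    using rcosets_stabL arrows_connected by fastforce
  also have "\<dots> = {rho {b} |x y b. b \<in> arrows x y}"
    using gt_R_eq_rho by blast
  also have "\<dots> = (\<lambda>b. rho {b}) ` At"
    using ex_arrows arrows_At by blast
  finally have "carrier (gt_algebra frame) = {\<Union> S |S. S \<subseteq> (\<lambda>b. rho {b}) ` At}"
    by (simp add: gt_algebra_def)
  also have "\<dots> = {\<Union> ((\<lambda>b. rho {b}) ` X) |X. X \<subseteq> At}"
    by (auto simp: subset_image_iff)
  also have "\<dots> = rho ` Pow At"
    unfolding rho_Union[symmetric] by blast
  finally show ?thesis .
qed

lemma rho_Un: "rho (X \<union> Y) = rho X \<union> rho Y"
  by (auto simp: rho_def)

text \<open>Every pair over connected vertices carries exactly one label, and the label is an
  atom.\<close>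

lemma rho_compl:
  "rho (At - X) = (\<Union>(x, y)\<in>connected. arrows x x \<times> arrows y y) - rho X" (is "_ = ?R")
proof (rule Set.set_eqI)
  fix p
  show "p \<in> rho (At - X) \<longleftrightarrow> p \<in> ?R"
  proof (cases "\<exists>x y g k. p = (g, k) \<and> g \<in> arrows x x \<and> k \<in> arrows y y \<and> (x, y) \<in> connected")
    case True
    then obtain x y g k where p: "p = (g, k)" "g \<in> arrows x x" "k \<in> arrows y y" "(x, y) \<in> connected"
      by blast
    then show ?thesis
      using rho_iff[OF p(2-4)] act_base_arrows[OF p(2-4)] arrows_At by auto
  next
    case False
    then show ?thesis by (auto elim: rhoE)
  qed
qed

lemma rho_conv:
  assumes "X \<subseteq> At"
  shows "rho (cv ` X) = (rho X)\<inverse>"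
proof -
  have *: "(k, g) \<in> rho (cv ` Y)" if gk: "(g, k) \<in> rho Y" for g k Y
  proof -
    obtain x y where xy: "g \<in> arrows x x" "k \<in> arrows y y" "(x, y) \<in> connected"
        "cv g \<odot> (base x y \<odot> k) \<in> Y"
      using gk unfolding rho_def by blast
    note a = base_arrows[OF xy(3)]
    \<comment> \<open>The converse of the label of \<open>(g, k)\<close> is the label of
      \<open>(k, g)\<close>, because base atoms respect converse.\<close>
    have "cv (cv g \<odot> (base x y \<odot> k)) = (cv k \<odot> cv (base x y)) \<odot> g"
      using cv_act_left[OF cv_arrows[OF xy(1)] act_right[OF a xy(2)]] cv_act_right[OF a xy(2)]
        cv_cv[OF arrows_At[OF xy(1)]] by simp
    also have "\<dots> = cv k \<odot> (base y x \<odot> g)"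
      using act_middle_assoc[OF cv_arrows[OF xy(2)] cv_arrows[OF a] xy(1)] base_sym[OF xy(3)] by simp
    finally show ?thesis
      using rho_iff[OF xy(2,1) connected_sym[OF xy(3)]] xy(4) by (metis image_eqI)
  qed
  \<comment> \<open>Involution gives the opposite inclusion from the one just proved.\<close>
  have "cv ` cv ` X = X"
    using assms cv_cv by (force simp: image_image subset_iff)
  then have "(g, k) \<in> rho (cv ` X) \<longleftrightarrow> (k, g) \<in> rho X" for g k
    using * by metis
  then show ?thesis by auto
qed

text \<open>A label \<open>j\<close> in \<open>J\<close> forces both vertices to be
  \<open>j\<close>, where the base atom is the unit; the label condition then reads
  \<open>cv g \<odot> k = j\<close>, that is \<open>g = k\<close>.\<close>

lemma rho_id: "rho J = Id_on (\<Union>x\<in>J. arrows x x)"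
proof -
  have diag: "g = k" if "g \<in> arrows x x" "k \<in> arrows y y" "(x, y) \<in> connected"
      "cv g \<odot> (base x y \<odot> k) \<in> J" for g k x y
  proof -
    define j where "j = cv g \<odot> (base x y \<odot> k)"
    have xy: "x = j" "y = j"
      using arrows_unique[OF act_base_arrows[OF that(1-3)] J_arrows[OF that(4)]] j_def by auto
    have g: "g \<in> arrows j j" and k: "k \<in> arrows j j"
      using that(1,2) xy by auto
    have "cv g \<odot> k = j"
      using j_def[unfolded xy] act_left_id[OF k] by (metis base_refl)
    then show ?thesis
      using act_left_cancel(2)[OF g k] act_right_id[OF g] xy by simp
  qed
  have "(g, g) \<in> rho J" if "x \<in> J" "g \<in> arrows x x" for x g
    using rho_iff[OF that(2,2) connected_refl[OF that(1)]] that
    by (simp add: base_refl act_left_id cv_act_self)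
  then have "Id_on (\<Union>x\<in>J. arrows x x) \<subseteq> rho J"
    by auto
  moreover have "p \<in> Id_on (\<Union>x\<in>J. arrows x x)" if "p \<in> rho J" for p
    using that
  proof (rule rhoE)
    fix x y g k
    assume p: "p = (g, k)" and gk: "g \<in> arrows x x" "k \<in> arrows y y" "(x, y) \<in> connected"
      "cv g \<odot> (base x y \<odot> k) \<in> J"
    have "g = k" using diag[OF gk] .
    moreover have "x \<in> J" using arrows_J(1)[OF gk(1)] .
    ultimately show ?thesis using p gk(1) by auto
  qed
  ultimately show ?thesis by blast
qed

section \<open>The relative product\<close>

lemma gt_inv_image_iff:
  assumes M: "M \<subseteq> arrows y y" and xy: "(x, y) \<in> connected"
    and closed: "\<And>k k'. \<lbrakk>k \<in> M; k' \<in> arrows y y; base x y \<odot> k' = base x y \<odot> k\<rbrakk> \<Longrightarrow> k' \<in> M"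
  shows "g \<in> gt_inv_image frame x y M \<longleftrightarrow>
    g \<in> arrows x x \<and> (\<exists>k\<in>M. base x y \<odot> k = g \<odot> base x y)"
proof -
  note a = base_arrows[OF xy]
  have "gt_inv_image frame x y M = (\<Union>b\<in>{b \<in> arrows x y. cosR x y b \<subseteq> M}. cosL x y b)"
    unfolding gt_inv_image_def frame_simps rcosets_stabR[OF xy]
    using xy by (auto simp: phi_inv_cosR)
  then have "g \<in> gt_inv_image frame x y M \<longleftrightarrow>
      g \<in> arrows x x \<and> cosR x y (g \<odot> base x y) \<subseteq> M"
    using a act_left by (auto simp: cosL_def)
  also have "\<dots> \<longleftrightarrow> g \<in> arrows x x \<and> (\<exists>k\<in>M. base x y \<odot> k = g \<odot> base x y)"
  proof (rule conj_cong[OF refl])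
    assume g: "g \<in> arrows x x"
    obtain k where "k \<in> cosR x y (g \<odot> base x y)"
      using cosR_nonempty[OF act_left[OF g a] xy] by blast
    then show "cosR x y (g \<odot> base x y) \<subseteq> M \<longleftrightarrow> (\<exists>k\<in>M. base x y \<odot> k = g \<odot> base x y)"
      using closed M by (auto simp: cosR_def)
  qed
  finally show ?thesis .
qed

text \<open>A member of the right side is \<open>g \<odot> s\<close> with \<open>s\<close> an offset
  and \<open>g\<close> corresponding to some \<open>p \<odot> q\<close>, where \<open>p\<close>
  produces \<open>b\<close> and \<open>q\<close> produces \<open>d\<close> from the base atoms.
  Acting by \<open>g\<close> on the offset triangle and passing \<open>q\<close> across the middle
  gives \<open>T b d c\<close>; each move is reversible.\<close>

lemma cosL_subset_product_iff:
  assumes b: "b \<in> arrows x y" and d: "d \<in> arrows y z" and c: "c \<in> arrows x z"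
  shows "cosL x z c \<subseteq> gt_inv_image frame x y (cosR x y b <#>\<^bsub>vertex_group y\<^esub> cosL y z d)
      <#>\<^bsub>vertex_group x\<^esub> offset x y z \<longleftrightarrow> T b d c"
proof -
  note xy = arrows_connected[OF b] and yz = arrows_connected[OF d] and xz = arrows_connected[OF c]
  let ?a = "base x y" and ?b = "base y z" and ?e = "base x z"
  note A = base_arrows[OF xy] and B = base_arrows[OF yz] and E = base_arrows[OF xz]
  let ?M = "cosR x y b <#>\<^bsub>vertex_group y\<^esub> cosL y z d"
  have M: "?M = {p \<odot> q |p q. p \<in> cosR x y b \<and> q \<in> cosL y z d}"
    by (auto simp: set_mult_def)
  have My: "?M \<subseteq> arrows y y"
    unfolding M by (auto simp: cosR_def cosL_def intro: act_left)
  have closed: "k' \<in> ?M" if k: "k \<in> ?M" "k' \<in> arrows y y" "?a \<odot> k' = ?a \<odot> k" for k k'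
  proof -
    obtain p q where pq: "k = p \<odot> q" "p \<in> arrows y y" "?a \<odot> p = b" "q \<in> arrows y y" "q \<odot> ?b = d"
      using k(1) unfolding M by (auto simp: cosR_def cosL_def)
    have "?a \<odot> (k' \<odot> cv q) = (?a \<odot> k) \<odot> cv q"
      using act_right_assoc[OF A k(2) cv_arrows[OF pq(4)]] k(3) by simp
    also have "\<dots> = b"
      using act_right_assoc[OF A pq(2,4)] act_right_cancel(1)[OF b pq(4)] pq by simp
    finally have "k' \<odot> cv q \<in> cosR x y b"
      using act_left[OF k(2) cv_arrows[OF pq(4)]] by (simp add: cosR_def)
    moreover have "k' = (k' \<odot> cv q) \<odot> q"
      using act_right_cancel(2)[OF k(2) pq(4)] by simp
    ultimately show ?thesis
      using pq unfolding M by (auto simp: cosL_def)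
  qed
  have inv_image: "g \<in> gt_inv_image frame x y ?M \<longleftrightarrow>
      g \<in> arrows x x \<and> (\<exists>k\<in>?M. ?a \<odot> k = g \<odot> ?a)" for g
    by (rule gt_inv_image_iff[OF My xy]) (rule closed)
  have mem: "T b d c" if r: "r \<in> cosL x z c"
    "r \<in> gt_inv_image frame x y ?M <#>\<^bsub>vertex_group x\<^esub> offset x y z" for r
  proof -
    obtain g s where "r = g \<odot> s" "g \<in> gt_inv_image frame x y ?M" "s \<in> offset x y z"
      using r(2) unfolding set_mult_def[of "vertex_group x"] vertex_group_simps by blast
    then obtain k where g: "r = g \<odot> s" "g \<in> arrows x x" "k \<in> ?M" "?a \<odot> k = g \<odot> ?a"
      and s: "s \<in> arrows x x" "T ?a ?b (s \<odot> ?e)"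
      unfolding inv_image offset_def by blast
    obtain p q where pq: "k = p \<odot> q" "p \<in> arrows y y" "?a \<odot> p = b" "q \<in> arrows y y" "q \<odot> ?b = d"
      using g(3) unfolding M by (auto simp: cosR_def cosL_def)
    have "T (g \<odot> ?a) ?b c"
      using T_act_left[OF s(2) g(2) A B] act_left_assoc[OF g(2) s(1) E] r(1) g(1)
      by (simp add: cosL_def)
    then have "T (b \<odot> q) ?b c"
      using act_right_assoc[OF A pq(2,4)] pq g(4) by simp
    then show ?thesis
      using T_act_middle[OF b pq(4) B] pq by simp
  qed
  have "r \<in> gt_inv_image frame x y ?M <#>\<^bsub>vertex_group x\<^esub> offset x y z"
    if r: "r \<in> cosL x z c" and Tc: "T b d c" for r
  proof -
    have rx: "r \<in> arrows x x" "r \<odot> ?e = c" using r by (auto simp: cosL_def)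
    obtain p where p: "p \<in> arrows y y" "?a \<odot> p = b"
      using cosR_nonempty[OF b xy] by (auto simp: cosR_def)
    obtain q where q: "q \<in> arrows y y" "q \<odot> ?b = d"
      using cosL_nonempty[OF d yz] by (auto simp: cosL_def)
    have pq: "p \<odot> q \<in> arrows y y" using act_left[OF p(1) q(1)] .
    obtain g where g: "g \<in> arrows x x" "?a \<odot> (p \<odot> q) = g \<odot> ?a"
      using transitive_left[OF A act_right[OF A pq]] by blast
    have "T (b \<odot> q) ?b c"
      using T_act_middle[OF b q(1) B] q Tc by simp
    then have "T (g \<odot> ?a) ?b c"
      using act_right_assoc[OF A p(1) q(1)] p g by simp
    then have "T (cv g \<odot> (g \<odot> ?a)) ?b (cv g \<odot> (r \<odot> ?e))"
      using T_act_left[OF _ cv_arrows[OF g(1)] act_left[OF g(1) A] B] rx by blast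
    \<comment> \<open>The factorization of \<open>r\<close> is \<open>g\<close> times this
      offset.\<close>
    then have "cv g \<odot> r \<in> offset x y z"
      using act_left_cancel(1)[OF g(1) A] act_left_assoc[OF cv_arrows[OF g(1)] rx(1) E]
        act_left[OF cv_arrows[OF g(1)] rx(1)] by (simp add: offset_def)
    moreover have "g \<in> gt_inv_image frame x y ?M"
      using inv_image g p q unfolding M by (auto simp: cosR_def cosL_def)
    moreover have "r = g \<odot> (cv g \<odot> r)"
      using act_left_cancel(2)[OF g(1) rx(1)] by simp
    ultimately show ?thesis
      by (auto simp: set_mult_def)
  qed
  \<comment> \<open>As \<open>cosL x z c\<close> is nonempty, the inclusion supplies a member to
    which \<open>mem\<close> applies.\<close>
  then show ?thesis
    using mem cosL_nonempty[OF c xz] by blast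
qed

lemma gt_R_mult_eq_rho:
  assumes b: "b \<in> arrows x y" and d: "d \<in> arrows y z"
  shows "gt_R_mult frame x y z (cosL x y b) (cosL y z d) = rho {c. T b d c}"
proof -
  note xy = arrows_connected[OF b] and yz = arrows_connected[OF d]
  have xz: "(x, z) \<in> connected" using connected_trans xy yz .
  let ?N = "gt_inv_image frame x y (cosR x y b <#>\<^bsub>vertex_group y\<^esub> cosL y z d)
      <#>\<^bsub>vertex_group x\<^esub> offset x y z"
  have "gt_R_mult frame x y z (cosL x y b) (cosL y z d) =
      \<Union> {gt_R frame x z (cosL x z c) |c. c \<in> arrows x z \<and> cosL x z c \<subseteq> ?N}"
    unfolding gt_R_mult_def frame_simps rcosets_stabL[OF xz] phi_cosL[OF b xy] by blast
  also have "\<dots> = \<Union> {rho {c} |c. c \<in> arrows x z \<and> T b d c}"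
    by (intro arg_cong[of _ _ Union] Collect_cong iff_exI)
      (metis gt_R_eq_rho cosL_subset_product_iff[OF b d])
  also have "\<dots> = rho {c. T b d c}"
  proof -
    have "\<Union> {rho {c} |c. c \<in> arrows x z \<and> T b d c} = (\<Union>c\<in>{c. T b d c}. rho {c})"
      using T_arrows(2)[OF _ b d] by blast
    then show ?thesis by (simp only: rho_Union[of "{c. T b d c}"])
  qed
  finally show ?thesis .
qed

lemma gt_mult_rho:
  assumes "X \<subseteq> At" "Y \<subseteq> At"
  shows "gt_mult frame (rho X) (rho Y) = rho {c. \<exists>a\<in>X. \<exists>b\<in>Y. T a b c}"
proof -
  have sub: "gt_R frame x y (cosL x y b) \<subseteq> rho Z \<longleftrightarrow> b \<in> Z" if "b \<in> arrows x y" for x y b Z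
    using that by (simp add: gt_R_eq_rho rho_singleton_subset arrows_At)
  have "gt_mult frame (rho X) (rho Y) =
      \<Union> {gt_R_mult frame x y z (cosL x y b) (cosL y z d) |x y z b d.
        b \<in> arrows x y \<and> d \<in> arrows y z \<and> b \<in> X \<and> d \<in> Y}"
  proof -
    have "{gt_R_mult frame x y z \<alpha> \<beta> |x y z \<alpha> \<beta>.
        (x, y) \<in> connected \<and> \<alpha> \<in> rcosets\<^bsub>vertex_group x\<^esub> stabL x y \<and> gt_R frame x y \<alpha> \<subseteq> rho X \<and>
        (y, z) \<in> connected \<and> \<beta> \<in> rcosets\<^bsub>vertex_group y\<^esub> stabL y z \<and> gt_R frame y z \<beta> \<subseteq> rho Y} =
      {gt_R_mult frame x y z (cosL x y b) (cosL y z d) |x y z b d.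
        b \<in> arrows x y \<and> d \<in> arrows y z \<and> b \<in> X \<and> d \<in> Y}" (is "?L = ?R")
    proof
      show "?L \<subseteq> ?R"
      proof
        fix p assume "p \<in> ?L"
        then obtain x y z \<alpha> \<beta> where p: "p = gt_R_mult frame x y z \<alpha> \<beta>"
          "(x, y) \<in> connected" "\<alpha> \<in> rcosets\<^bsub>vertex_group x\<^esub> stabL x y" "gt_R frame x y \<alpha> \<subseteq> rho X"
          "(y, z) \<in> connected" "\<beta> \<in> rcosets\<^bsub>vertex_group y\<^esub> stabL y z" "gt_R frame y z \<beta> \<subseteq> rho Y"
          by blast
        then obtain b d where "b \<in> arrows x y" "\<alpha> = cosL x y b" "d \<in> arrows y z" "\<beta> = cosL y z d"
          using rcosets_stabL by (metis imageE)
        then show "p \<in> ?R"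
          using p sub by blast
      qed
      show "?R \<subseteq> ?L"
      proof
        fix p assume "p \<in> ?R"
        then obtain x y z b d where p: "p = gt_R_mult frame x y z (cosL x y b) (cosL y z d)"
          "b \<in> arrows x y" "d \<in> arrows y z" "b \<in> X" "d \<in> Y"
          by blast
        moreover have "cosL x y b \<in> rcosets\<^bsub>vertex_group x\<^esub> stabL x y"
          "cosL y z d \<in> rcosets\<^bsub>vertex_group y\<^esub> stabL y z"
          using p arrows_connected rcosets_stabL by auto
        ultimately show "p \<in> ?L"
          using sub arrows_connected by blast
      qed
    qed
    then show ?thesis
      unfolding gt_mult_def frame_simps by (rule arg_cong)
  qed
  also have "\<dots> = \<Union> {rho {c. T b d c} |x y z b d.
      b \<in> arrows x y \<and> d \<in> arrows y z \<and> b \<in> X \<and> d \<in> Y}"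
    using gt_R_mult_eq_rho by blast
  also have "\<dots> = \<Union> {rho {c. T b d c} |b d. b \<in> X \<and> d \<in> Y}" (is "?L = ?R")
  proof -
    \<comment> \<open>The endpoints may be dropped from the indexing: if \<open>b\<close> and
      \<open>d\<close> are not composable, no \<open>c\<close> satisfies \<open>T b d c\<close> and
      the pair contributes the empty relation.\<close>
    have "\<exists>x y z. b \<in> arrows x y \<and> d \<in> arrows y z" if bd: "p \<in> rho {c. T b d c}" for b d p
    proof -
      obtain c where T: "T b d c" using bd by (auto elim: rhoE)
      then obtain x y y' z where b: "b \<in> arrows x y" and d: "d \<in> arrows y' z"
        using T_closed ex_arrows by blast
      then show ?thesis using T_arrows(1)[OF T b d] by blast
    qed
    note ex = this
    show ?thesis
    proof (intro equalityI subsetI)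
      fix p assume "p \<in> ?R"
      then obtain b d where bd: "b \<in> X" "d \<in> Y" "p \<in> rho {c. T b d c}" by blast
      then obtain x y z where "b \<in> arrows x y" "d \<in> arrows y z" using ex by blast
      then show "p \<in> ?L" using bd by blast
    next
      fix p assume "p \<in> ?L"
      then obtain b d where "b \<in> X" "d \<in> Y" "p \<in> rho {c. T b d c}" by blast
      then show "p \<in> ?R" by blast
    qed
  qed
  also have "\<dots> = rho {c. \<exists>a\<in>X. \<exists>b\<in>Y. T a b c}"
    by (auto simp: rho_def)
  finally show ?thesis .
qed

section \<open>The isomorphism of the complex algebra with the coset algebra\<close>

lemma rho_hom: "rho \<in> ra_hom (complex_algebra At T cv J) (gt_algebra frame)"
  unfolding ra_hom_def
proof (intro CollectI conjI ballI)
  show "rho \<in> carrier (complex_algebra At T cv J) \<rightarrow> carrier (gt_algebra frame)"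
    by (simp add: carrier_gt_algebra)
qed (simp_all add: gt_algebra_def rho_Un rho_compl rho_conv rho_id gt_mult_rho)

lemma rho_bij:
  "bij_betw rho (carrier (complex_algebra At T cv J)) (carrier (gt_algebra frame))"
proof -
  have "X \<subseteq> Y" if "rho X = rho Y" "X \<subseteq> At" for X Y
  proof
    fix b assume "b \<in> X"
    then show "b \<in> Y"
      using that rho_singleton_subset[of b X] rho_singleton_subset[of b Y] by auto
  qed
  then show ?thesis
    by (auto simp: bij_betw_def carrier_gt_algebra intro!: inj_onI)
qed

end

section \<open>Transfer along isomorphisms, measurability on atoms and the conclusion\<close>

lemma relation_algebra_transfer:
  assumes "relation_algebra A" "h \<in> ra_hom A B" "bij_betw h (carrier A) (carrier B)"
  shows "relation_algebra B"
proof -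
  interpret A: relation_algebra A by fact
  have carrier: "carrier B = h ` carrier A" and inj: "inj_on h (carrier A)"
    using assms(3) by (auto simp: bij_betw_def)
  have ops: "\<And>a b. \<lbrakk>a \<in> carrier A; b \<in> carrier A\<rbrakk> \<Longrightarrow> h a \<uplus>\<^bsub>B\<^esub> h b = h (a \<uplus>\<^bsub>A\<^esub> b)"
    "\<And>a. a \<in> carrier A \<Longrightarrow> \<sim>\<^bsub>B\<^esub> h a = h (\<sim>\<^bsub>A\<^esub> a)"
    "\<And>a b. \<lbrakk>a \<in> carrier A; b \<in> carrier A\<rbrakk> \<Longrightarrow> h a ;;\<^bsub>B\<^esub> h b = h (a ;;\<^bsub>A\<^esub> b)"
    "\<And>a. a \<in> carrier A \<Longrightarrow> conv\<^bsub>B\<^esub> (h a) = h (conv\<^bsub>A\<^esub> a)"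
    "\<iota>\<^bsub>B\<^esub> = h \<iota>\<^bsub>A\<^esub>"
    using assms(2) by (auto simp: ra_hom_def)
  \<comment> \<open>Zero is given by a definite description, so uniqueness in \<open>B\<close> has
    to be proved: another neutral \<open>z\<close> is compared with the image of zero by joining the
    two.\<close>
  have zero: "ra_zero B = h (ra_zero A)"
    unfolding ra_zero_def[of B]
  proof (rule the_equality)
    show "h (ra_zero A) \<in> carrier B \<and> (\<forall>a\<in>carrier B. a \<uplus>\<^bsub>B\<^esub> h (ra_zero A) = a)"
      by (auto simp: carrier ops A.zero_closed A.join_zero)
    fix z assume "z \<in> carrier B \<and> (\<forall>a\<in>carrier B. a \<uplus>\<^bsub>B\<^esub> z = a)"
    then obtain c where c: "c \<in> carrier A" "z = h c" "h (ra_zero A) \<uplus>\<^bsub>B\<^esub> h c = h (ra_zero A)"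
      by (auto simp: carrier A.zero_closed)
    then have "h c = h (ra_zero A)"
      by (simp add: ops A.zero_closed A.join_commute[of "ra_zero A"] A.join_zero)
    then show "z = h (ra_zero A)" using c by simp
  qed
  have meet: "ra_meet B (h a) (h b) = h (ra_meet A a b)"
    if "a \<in> carrier A" "b \<in> carrier A" for a b
    using that by (simp add: ra_meet_def ops A.bool_closed)
  have one: "ra_one B = h (ra_one A)"
    by (simp add: ra_one_def zero ops A.zero_closed)
  show ?thesis
    by unfold_locales
      (auto simp: carrier ops zero meet one A.bool_closed A.comp_closed A.conv_closed A.id_closed
        intro!: arg_cong[where f = h]
        intro: A.join_assoc A.join_commute A.meet_assoc A.meet_commute A.meet_join_distrib
          A.join_meet_distrib A.join_zero A.meet_one A.join_compl A.meet_compl A.comp_assoc A.comp_id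
          A.conv_conv A.conv_comp A.join_comp_distrib A.conv_join A.tarski)
qed

lemma ra_hom_comp: "\<lbrakk>f \<in> ra_hom A B; g \<in> ra_hom B C\<rbrakk> \<Longrightarrow> g \<circ> f \<in> ra_hom A C"
  by (auto simp: ra_hom_def Pi_iff)

lemma ra_isomorphic_trans: "\<lbrakk>ra_isomorphic A B; ra_isomorphic B C\<rbrakk> \<Longrightarrow> ra_isomorphic A C"
  unfolding ra_isomorphic_def by (meson bij_betw_trans ra_hom_comp)

text \<open>A loop \<open>a\<close> at \<open>i\<close> lies below \<open>i ; 1 ; i\<close>, a
  supremum of functions, hence below one function by complete primeness; elements below functions
  are functions.\<close>

lemma measured_atom_structure_of_relation_algebra:
  assumes "relation_algebra B" "ra_atomic B" "ra_measurable B"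
  shows "measured_atom_structure {x. ra_atom B x}
     (\<lambda>a b c. ra_atom B a \<and> ra_atom B b \<and> ra_atom B c \<and> ra_le B c (a ;;\<^bsub>B\<^esub> b))
     (ra_conv B) {x. ra_atom B x \<and> ra_le B x \<iota>\<^bsub>B\<^esub>}"
proof (intro measured_atom_structure.intro measured_atom_structure_axioms.intro
    atom_structure_of_relation_algebra assms(1,2))
  interpret B: relation_algebra B by fact
  note closed = B.atom_closed B.comp_closed B.conv_closed B.id_closed B.one_closed
  fix i a c
  assume "i \<in> {x. ra_atom B x \<and> ra_le B x \<iota>\<^bsub>B\<^esub>}"
    and "ra_atom B i \<and> ra_atom B a \<and> ra_atom B a \<and> ra_le B a (i ;;\<^bsub>B\<^esub> a)"
    and "ra_atom B a \<and> ra_atom B i \<and> ra_atom B a \<and> ra_le B a (a ;;\<^bsub>B\<^esub> i)"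
    and "ra_atom B (conv\<^bsub>B\<^esub> a) \<and> ra_atom B a \<and> ra_atom B c \<and> ra_le B c (conv\<^bsub>B\<^esub> a ;;\<^bsub>B\<^esub> a)"
  then have i: "ra_atom B i" "ra_le B i \<iota>\<^bsub>B\<^esub>" and a: "ra_atom B a" "ra_le B a (i ;;\<^bsub>B\<^esub> a)"
    "ra_le B a (a ;;\<^bsub>B\<^esub> i)" and c: "ra_atom B c" "ra_le B c (conv\<^bsub>B\<^esub> a ;;\<^bsub>B\<^esub> a)"
    by auto
  obtain S where S: "\<forall>x\<in>S. measurable_atom B x" "ra_is_sup B S \<iota>\<^bsub>B\<^esub>"
    using assms by (auto simp: ra_measurable_def)
  \<comment> \<open>The atom \<open>i\<close> lies below one of the measurable atoms whose sum is
    the identity, and therefore equals it.\<close>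
  then have "measurable_atom B i"
    using B.atom_le_sup[OF i(1) S(2) i(2)] B.atoms_eq[OF i(1)]
    unfolding measurable_atom_def by metis
  then obtain P where P: "\<forall>f\<in>P. ra_function B f" "ra_is_sup B P (i ;;\<^bsub>B\<^esub> ra_one B ;;\<^bsub>B\<^esub> i)"
    by (auto simp: measurable_atom_def)
  have "ra_le B (i ;;\<^bsub>B\<^esub> a) (i ;;\<^bsub>B\<^esub> ra_one B)"
    using i a by (intro B.comp_mono) (simp_all add: closed B.le_refl B.le_one)
  then have "ra_le B a (i ;;\<^bsub>B\<^esub> ra_one B)"
    using B.le_trans[OF a(2)] i a by (simp add: closed)
  then have "ra_le B (a ;;\<^bsub>B\<^esub> i) (i ;;\<^bsub>B\<^esub> ra_one B ;;\<^bsub>B\<^esub> i)"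
    using i a by (intro B.comp_mono) (simp_all add: closed B.le_refl)
  then have "ra_le B a (i ;;\<^bsub>B\<^esub> ra_one B ;;\<^bsub>B\<^esub> i)"
    using B.le_trans[OF a(3)] i a by (simp add: closed)
  then obtain f where f: "f \<in> P" "ra_le B a f"
    using B.atom_le_sup[OF a(1) P(2)] by blast
  then have fun_f: "f \<in> carrier B" "ra_le B (conv\<^bsub>B\<^esub> f ;;\<^bsub>B\<^esub> f) \<iota>\<^bsub>B\<^esub>"
    using P by (auto simp: ra_function_def)
  have "ra_le B (conv\<^bsub>B\<^esub> a ;;\<^bsub>B\<^esub> a) (conv\<^bsub>B\<^esub> f ;;\<^bsub>B\<^esub> f)"
    using a f fun_f by (intro B.comp_mono B.conv_mono) (simp_all add: closed)
  then have "ra_le B (conv\<^bsub>B\<^esub> a ;;\<^bsub>B\<^esub> a) \<iota>\<^bsub>B\<^esub>"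
    using B.le_trans[OF _ fun_f(2)] a fun_f by (simp add: closed)
  then have "ra_le B c \<iota>\<^bsub>B\<^esub>"
    using B.le_trans[OF c(2)] a c by (simp add: closed)
  then show "c \<in> {x. ra_atom B x \<and> ra_le B x \<iota>\<^bsub>B\<^esub>}"
    using c by simp
qed

theorem theorem7p2:
  fixes B :: "'a rel_alg"
  assumes "relation_algebra B" and "ra_atomic B" and "ra_measurable B"
  shows "\<exists>F :: ('a, 'a) group_triple.
    coset_relation_algebra F \<and> essentially_isomorphic B (gt_algebra F)"
proof -
  interpret M: measured_atom_structure "{x. ra_atom B x}"
    "\<lambda>a b c. ra_atom B a \<and> ra_atom B b \<and> ra_atom B c \<and> ra_le B c (a ;;\<^bsub>B\<^esub> b)"
    "ra_conv B" "{x. ra_atom B x \<and> ra_le B x \<iota>\<^bsub>B\<^esub>}"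
    using assms by (rule measured_atom_structure_of_relation_algebra)
  note rho = M.rho_hom[folded atom_algebra_def] M.rho_bij[folded atom_algebra_def]
  have "ra_isomorphic (atom_algebra B) (gt_algebra M.frame)"
    using rho by (auto simp: ra_isomorphic_def)
  \<comment> \<open>The atom algebra witnesses existence of a completion, and every other completion
    reaches the coset algebra through it.\<close>
  then have "essentially_isomorphic B (gt_algebra M.frame)"
    using assms atom_algebra_completion completion_iso_atom_algebra ra_isomorphic_trans
    unfolding essentially_isomorphic_def by blast
  moreover have "coset_relation_algebra M.frame"
    using M.semi_frame_frame relation_algebra_transfer[OF relation_algebra_atom_algebra rho] assms
    by (simp add: coset_relation_algebra_def)
  ultimately show ?thesis by blast
qed

end
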